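(* Let $\mathcal T$ be a triangulation of a surface $S$ of topological type $(g,n)$ and let $\Theta:E\to[0,\pi)$ satisfy condition $\mathbf{(C1)}$. In hyperbolic background geometry, the curvature map $Th:\mathbb R_+^{|V|}\to\mathbb R^{|V|}$ is injective, and its image consists exactly of the vectors $(K_1,\dots,K_{|V|})$ satisfying $K_i<2\pi$ for $v_i\in V\setminus V_\partial$ and $K_i<\pi$ for $v_i\in V_\partial$, and, for every non-empty subset $A\subseteq V$, $$\sum_{v_i\in A}K_i>-\sum_{(e,v)\in Lk(A)}(\pi-\Theta(e))+2\pi\chi(G(A)\setminus\partial S)+\pi\chi(G(A)\cap\partial S).$$
   Context: $S$ is a compact oriented surface of genus $g$ whose boundary consists of $n\ge0$ disjoint simple closed curves. $\mathcal T$ has vertex set $V=\{v_1,\dots,v_{|V|}\}$, edge set $E$, triangle set $F$; $V_\partial\subseteq V$ is the set of boundary vertices. Condition $\mathbf{(C1)}$: whenever edges $e_1,e_2,e_3$ bound a triangle of $\mathcal T$, $I(e_1)+I(e_2)I(e_3)\ge0$, $I(e_2)+I(e_3)I(e_1)\ge0$, $I(e_3)+I(e_1)I(e_2)\ge0$ with $I(e)=\cos\Theta(e)$. Curvature map (hyperbolic): for a radius vector $r=(r_1,\dots,r_{|V|})\in\mathbb R_+^{|V|}$, each triangle with vertices $v_i,v_j,v_k$ is realized as the hyperbolic triangle with side lengths $l_{ij}=\cosh^{-1}(\cosh r_i\cosh r_j+\sinh r_i\sinh r_j\cos\Theta([v_i,v_j]))$ and similarly $l_{jk},l_{ki}$ (under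 $\mathbf{(C1)}$ these satisfy the triangle inequalities; this is the triangle of centers of three disks of radii $r_i,r_j,r_k$ meeting at exterior angles given by $\Theta$). Gluing these triangles along common edges gives a hyperbolic cone metric on $S$. The cone angle $\sigma(v_i)$ is the sum of the inner angles at $v_i$ of all triangles incident to $v_i$; the vertex curvature is $K_i=2\pi-\sigma(v_i)$ if $v_i\notin V_\partial$ and $K_i=\pi-\sigma(v_i)$ if $v_i\in V_\partial$; $Th(r)=(K_1,\dots,K_{|V|})$. For non-empty $A\subseteq V$: $G(A)$ is the union of the (open) cells of $\mathcal T$ (vertices, open edges, open triangles) having at least one vertex in $A$; for such a union $X$ of open cells, $\chi(X)$ denotes the number of $0$-cells minus the number of $1$-cells plus the number of $2$-cells contained in $X$ (so $G(A)\setminus\partial S$ and $G(A)\cap\partial S$ consist of the cells of $G(A)$ not in, resp. in, $\partial S$). $Lk(A)$ is the set of pairs $(e,v)$ with $e\in E$, $v\in A$, no endpoint of $e$ in $A$, and $e$ and $v$ forming a triangle of $\mathcal T$. *)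

theory Defs
  imports Complex_Main
begin

text \<open>Combinatorial (simplicial) triangulation: vertices of type 'v, triangles are
  3-element vertex sets, edges are 2-element vertex sets.\<close>

definition tri_edges :: "'v set set \<Rightarrow> 'v set set" where
  "tri_edges F = {e. card e = 2 \<and> (\<exists>f\<in>F. e \<subseteq> f)}"

definition edge_deg :: "'v set set \<Rightarrow> 'v set \<Rightarrow> nat" where
  "edge_deg F e = card {f\<in>F. e \<subseteq> f}"

definition bd_edges :: "'v set set \<Rightarrow> 'v set set" where
  "bd_edges F = {e\<in>tri_edges F. edge_deg F e = 1}"

definition bd_verts :: "'v set set \<Rightarrow> 'v set" where
  "bd_verts F = {v. \<exists>e\<in>bd_edges F. v \<in> e}"

text \<open>Link of a vertex v: graph on the neighbours a with {v,a} an edge, a ~ b iff {v,a,b} is a triangle.\<close>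
definition link_connected :: "'v set set \<Rightarrow> 'v \<Rightarrow> bool" where
  "link_connected F v \<longleftrightarrow>
     (\<forall>a b. {v,a} \<in> tri_edges F \<longrightarrow> {v,b} \<in> tri_edges F \<longrightarrow>
        (a, b) \<in> {(x, y). {v, x, y} \<in> F}\<^sup>*)"

definition dedges :: "'v \<times> 'v \<times> 'v \<Rightarrow> ('v \<times> 'v) set" where
  "dedges t = (case t of (x, y, z) \<Rightarrow> {(x, y), (y, z), (z, x)})"

definition orientable_complex :: "'v set set \<Rightarrow> bool" where
  "orientable_complex F \<longleftrightarrow>
     (\<exists>ori :: 'v set \<Rightarrow> 'v \<times> 'v \<times> 'v.
        (\<forall>f\<in>F. (case ori f of (x, y, z) \<Rightarrow> f = {x, y, z})) \<and>
        (\<forall>f\<in>F. \<forall>g\<in>F. f \<noteq> g \<longrightarrow> dedges (ori f) \<inter> dedges (ori g) = {}))"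

text \<open>A triangulation of a compact connected oriented surface (possibly with boundary):
  every edge lies in one or two triangles and the link of every vertex is connected
  (hence a circle for interior vertices, an arc for boundary vertices).\<close>
definition tri_surface :: "'v set \<Rightarrow> 'v set set \<Rightarrow> bool" where
  "tri_surface V F \<longleftrightarrow>
     finite V \<and> F \<noteq> {} \<and> (\<forall>f\<in>F. f \<subseteq> V \<and> card f = 3) \<and> V = \<Union>F \<and>
     (\<forall>e\<in>tri_edges F. edge_deg F e = 1 \<or> edge_deg F e = 2) \<and>
     (\<forall>v\<in>V. link_connected F v) \<and>
     (\<forall>u\<in>V. \<forall>w\<in>V. (u, w) \<in> {(a, b). {a, b} \<in> tri_edges F}\<^sup>*) \<and>
     orientable_complex F"

text \<open>Condition (C1), with I(e) = cos(Theta e).\<close>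
definition cond_C1 :: "'v set set \<Rightarrow> ('v set \<Rightarrow> real) \<Rightarrow> bool" where
  "cond_C1 F \<Theta> \<longleftrightarrow>
     (\<forall>f\<in>F. \<forall>x y z. f = {x, y, z} \<and> x \<noteq> y \<and> y \<noteq> z \<and> x \<noteq> z \<longrightarrow>
        cos (\<Theta> {y, z}) + cos (\<Theta> {x, z}) * cos (\<Theta> {x, y}) \<ge> 0)"

text \<open>Hyperbolic edge length between disks of radii ri, rj meeting at angle th.\<close>
definition hlen :: "real \<Rightarrow> real \<Rightarrow> real \<Rightarrow> real" where
  "hlen ri rj th = arcosh (cosh ri * cosh rj + sinh ri * sinh rj * cos th)"

text \<open>Inner angle opposite to side a of a hyperbolic triangle with sides a, b, c
  (hyperbolic law of cosines).\<close>
definition hangle :: "real \<Rightarrow> real \<Rightarrow> real \<Rightarrow> real" where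
  "hangle a b c = arccos ((cosh b * cosh c - cosh a) / (sinh b * sinh c))"

text \<open>Inner angle at vertex v of the triangle f (the other two vertices u, w).\<close>
definition corner_angle :: "('v set \<Rightarrow> real) \<Rightarrow> ('v \<Rightarrow> real) \<Rightarrow> 'v set \<Rightarrow> 'v \<Rightarrow> real" where
  "corner_angle \<Theta> r f v =
     (let u = (SOME u. u \<in> f - {v}); w = (SOME w. w \<in> f - {v, u}) in
        hangle (hlen (r u) (r w) (\<Theta> {u, w})) (hlen (r v) (r u) (\<Theta> {v, u}))
               (hlen (r v) (r w) (\<Theta> {v, w})))"

text \<open>Discrete curvature map Th.\<close>
definition Th :: "'v set set \<Rightarrow> ('v set \<Rightarrow> real) \<Rightarrow> ('v \<Rightarrow> real) \<Rightarrow> 'v \<Rightarrow> real" where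
  "Th F \<Theta> r v = (if v \<in> bd_verts F then pi else 2 * pi) -
                  (\<Sum>f\<in>{f\<in>F. v \<in> f}. corner_angle \<Theta> r f v)"

text \<open>Euler characteristics of G(A) minus the boundary and of G(A) on the boundary.\<close>
definition chi_int :: "'v set set \<Rightarrow> 'v set \<Rightarrow> int" where
  "chi_int F A = int (card (A - bd_verts F))
     - int (card {e\<in>tri_edges F - bd_edges F. e \<inter> A \<noteq> {}})
     + int (card {f\<in>F. f \<inter> A \<noteq> {}})"

definition chi_bd :: "'v set set \<Rightarrow> 'v set \<Rightarrow> int" where
  "chi_bd F A = int (card (A \<inter> bd_verts F))
     - int (card {e\<in>bd_edges F. e \<inter> A \<noteq> {}})"

definition Lk :: "'v set set \<Rightarrow> 'v set \<Rightarrow> ('v set \<times> 'v) set" where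
  "Lk F A = {(e, v). e \<in> tri_edges F \<and> v \<in> A \<and> e \<inter> A = {} \<and> insert v e \<in> F}"

end

theory Submission
  imports Defs
begin

text \<open>In a single triangle, raising one radius does not lower the angles at the two other vertices,
  and strictly lowers the sum of the three angles; both follow from explicit derivatives, whose signs
  are read off from (C1).
  Injectivity is a maximum principle: if \<open>A\<close> is the set of vertices at which \<open>r'\<close> exceeds \<open>r\<close>, then
  the cone angles on \<open>A\<close> have a strictly smaller sum for \<open>r'\<close> than for \<open>r\<close>.
  For the image, Perron's method applies: the radius vectors whose cone angles are at most the
  prescribed ones are closed under pointwise minimum, and their infimum has the prescribed cone angles
  provided that it is positive. If it vanished exactly on \<open>A\<close>, the limit of the total cone angle on \<open>A\<close>
  would contradict the inequality for \<open>A\<close>. This limit is a sum over the triangles meeting \<open>A\<close>,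
  which double counting of edges turns into the Euler characteristic expression.\<close>

section \<open>Hyperbolic triangles in terms of the hyperbolic cosines of the sides\<close>

text \<open>In the hyperbolic cosines of the sides the law of cosines is algebraic, and the
  derivatives of the three angles share the factor \<open>1 / sqrt (tri_det x y z)\<close>, so
  derivatives of angle sums reduce to polynomial identities. The main obstacle is degeneration: if
  two or three radii of a triangle tend to zero, single angles need not converge, since they depend
  on the ratios of the radii. Limits and comparisons are therefore stated for the sum of the angles
  of a face over a subset of its vertices, which is just what splitting a cone angle sum over
  \<open>A\<close> by faces produces. The limit value is \<open>pi\<close> minus Theta of the
  opposite edge if one disk collapses, and \<open>pi\<close> if several do, because the area then
  vanishes and the angle at a remaining vertex tends to zero. The same number is a strict upper
  bound at positive radii, so it serves both directions of the description of the image.\<close>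

text \<open>In the next definitions \<open>x\<close>, \<open>y\<close>, \<open>z\<close> are the hyperbolic cosines of the side lengths, and
  \<open>tri_angle x y z\<close> is the angle opposite to the first side. The determinant is that of the Gram
  matrix of the vertices up to sign; it is positive iff the triangle exists and is nondegenerate.\<close>

definition tri_det :: "real \<Rightarrow> real \<Rightarrow> real \<Rightarrow> real" where
  "tri_det x y z = 1 - x\<^sup>2 - y\<^sup>2 - z\<^sup>2 + 2 * x * y * z"

definition tri_cos :: "real \<Rightarrow> real \<Rightarrow> real \<Rightarrow> real" where
  "tri_cos x y z = (y * z - x) / (sqrt (y\<^sup>2 - 1) * sqrt (z\<^sup>2 - 1))"

definition tri_angle :: "real \<Rightarrow> real \<Rightarrow> real \<Rightarrow> real" where
  "tri_angle x y z = arccos (tri_cos x y z)"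

lemma square_gt_1: "1 < x \<Longrightarrow> 0 < x\<^sup>2 - (1::real)"
  by (simp add: one_less_power)

lemma hangle_arcosh:
  assumes "1 \<le> x" "1 \<le> y" "1 \<le> z"
  shows "hangle (arcosh x) (arcosh y) (arcosh z) = tri_angle x y z"
  using assms by (simp add: hangle_def tri_angle_def tri_cos_def sinh_arcosh_real)

text \<open>The numerator comes from
  \<open>(y^2 - 1) * (z^2 - 1) - (y * z - x)^2 = tri_det x y z\<close>. It is symmetric in the
  sides, so the sines of the three angles share the numerator
  \<open>sqrt (tri_det x y z)\<close>.\<close>

lemma one_minus_tri_cos_square:
  assumes "1 < y" "1 < z"
  shows "1 - (tri_cos x y z)\<^sup>2 = tri_det x y z / ((y\<^sup>2 - 1) * (z\<^sup>2 - 1))"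
proof -
  have "0 < y\<^sup>2 - 1" "0 < z\<^sup>2 - 1"
    using assms by (auto intro!: square_gt_1)
  then show ?thesis
    by (simp add: tri_cos_def tri_det_def power_divide power_mult_distrib divide_simps)
       (simp add: algebra_simps power2_eq_square)
qed

lemma tri_cos_bounds:
  assumes "1 < y" "1 < z" "0 < tri_det x y z"
  shows "-1 < tri_cos x y z" "tri_cos x y z < 1"
proof -
  have "0 < 1 - (tri_cos x y z)\<^sup>2"
    unfolding one_minus_tri_cos_square[OF assms(1,2)]
    using assms square_gt_1 by simp
  then have "\<bar>tri_cos x y z\<bar> < 1"
    by (simp add: abs_square_less_1)
  then show "-1 < tri_cos x y z" "tri_cos x y z < 1" by auto
qed

lemma tri_angle_bounds:
  assumes "1 < y" "1 < z" "0 < tri_det x y z"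
  shows "0 < tri_angle x y z" "tri_angle x y z < pi"
  using arccos_lt_bounded[of "tri_cos x y z"] tri_cos_bounds[OF assms] by (simp_all add: tri_angle_def)

lemma cos_tri_angle:
  assumes "1 < y" "1 < z" "0 < tri_det x y z"
  shows "cos (tri_angle x y z) = tri_cos x y z"
  using tri_cos_bounds[OF assms] by (simp add: tri_angle_def cos_arccos)

lemma sin_tri_angle:
  assumes "1 < y" "1 < z" "0 < tri_det x y z"
  shows "sin (tri_angle x y z) = sqrt (tri_det x y z) / (sqrt (y\<^sup>2 - 1) * sqrt (z\<^sup>2 - 1))"
  using tri_cos_bounds[OF assms] 
  by (simp add: tri_angle_def sin_arccos one_minus_tri_cos_square[OF assms(1,2)] real_sqrt_divide real_sqrt_mult)

text \<open>The sine of the angle is \<open>W / (Y * Z)\<close>, so the square roots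
  \<open>Y\<close> and \<open>Z\<close> cancel and only rational terms over \<open>W\<close> remain.
  As \<open>W\<close> is common to all three angles, their derivatives can be added.\<close>

lemma DERIV_tri_angle:
  fixes x y z :: "real \<Rightarrow> real"
  assumes x: "(x has_real_derivative x') (at t)"
    and y: "(y has_real_derivative y') (at t)"
    and z: "(z has_real_derivative z') (at t)"
    and gt: "1 < y t" "1 < z t" "0 < tri_det (x t) (y t) (z t)"
  shows "((\<lambda>t. tri_angle (x t) (y t) (z t)) has_real_derivative
      (x' - y' * (x t * y t - z t) / ((y t)\<^sup>2 - 1) - z' * (x t * z t - y t) / ((z t)\<^sup>2 - 1))
      / sqrt (tri_det (x t) (y t) (z t))) (at t)"
proof -
  define Y where "Y = sqrt ((y t)\<^sup>2 - 1)"
  define Z where "Z = sqrt ((z t)\<^sup>2 - 1)"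
  define W where "W = sqrt (tri_det (x t) (y t) (z t))"
  have pos: "0 < (y t)\<^sup>2 - 1" "0 < (z t)\<^sup>2 - 1"
    using gt by (auto intro!: square_gt_1)
  have YZ: "0 < Y" "0 < Z" "0 < W" using pos gt by (auto simp: Y_def Z_def W_def)
  have sq: "(y t)\<^sup>2 = Y\<^sup>2 + 1" "(z t)\<^sup>2 = Z\<^sup>2 + 1"
    using pos by (auto simp: Y_def Z_def)
  have dsqrt: "((\<lambda>t. sqrt ((u t)\<^sup>2 - 1)) has_real_derivative u t * u' / sqrt ((u t)\<^sup>2 - 1)) (at t)"
    if "(u has_real_derivative u') (at t)" "0 < (u t)\<^sup>2 - 1" for u u'
  proof -
    have "((\<lambda>t. (u t)\<^sup>2 - 1) has_real_derivative 2 * u t * u') (at t)"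
      using DERIV_diff[OF DERIV_power[OF that(1), of 2] DERIV_const[of 1]] by (simp add: mult_ac)
    from DERIV_chain2[OF DERIV_real_sqrt[OF that(2)] this] show ?thesis
      by (rule DERIV_cong) (simp add: field_simps)
  qed
  note dY = dsqrt[OF y pos(1), folded Y_def] and dZ = dsqrt[OF z pos(2), folded Z_def]
  have "((\<lambda>t. tri_cos (x t) (y t) (z t)) has_real_derivative
     ((y' * z t + z' * y t - x') * (Y * Z)
        - (y t * z t - x t) * (y t * y' / Y * Z + z t * z' / Z * Y)) / (Y * Z * (Y * Z))) (at t)"
    unfolding tri_cos_def using YZ
    by (intro DERIV_cong[OF DERIV_divide[OF DERIV_diff[OF DERIV_mult[OF y z] x] DERIV_mult[OF dY dZ]]])
       (simp_all add: Y_def[symmetric] Z_def[symmetric])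
  from DERIV_arccos[OF tri_cos_bounds[OF gt]] this
  have D: "((\<lambda>t. tri_angle (x t) (y t) (z t)) has_real_derivative
     inverse (- sqrt (1 - (tri_cos (x t) (y t) (z t))\<^sup>2)) *
     (((y' * z t + z' * y t - x') * (Y * Z)
        - (y t * z t - x t) * (y t * y' / Y * Z + z t * z' / Z * Y)) / (Y * Z * (Y * Z)))) (at t)"
    unfolding tri_angle_def by (rule DERIV_chain2)
  have s: "sqrt (1 - (tri_cos (x t) (y t) (z t))\<^sup>2) = W / (Y * Z)"
    unfolding one_minus_tri_cos_square[OF gt(1,2)]
    by (simp add: real_sqrt_divide real_sqrt_mult W_def Y_def Z_def)
  have a: "(y' * z t + z' * y t - x') * (Y * Z)
        - (y t * z t - x t) * (y t * y' / Y * Z + z t * z' / Z * Y)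
      = - (Y * Z) * (x' - y' * (x t * y t - z t) / Y\<^sup>2 - z' * (x t * z t - y t) / Z\<^sup>2)"
  proof -
    have "((y' * z t + z' * y t - x') * Y\<^sup>2 * Z\<^sup>2
        - (y t * z t - x t) * (y t * y' * Z\<^sup>2 + z t * z' * Y\<^sup>2))
      = - (x' * Y\<^sup>2 * Z\<^sup>2 - y' * (x t * y t - z t) * Z\<^sup>2 - z' * (x t * z t - y t) * Y\<^sup>2)"
      using sq by algebra
    then show ?thesis using YZ by (simp add: divide_simps power2_eq_square) (simp add: algebra_simps)
  qed
  show ?thesis
    apply (rule DERIV_cong[OF D])
    unfolding s a using YZ
    by (simp add: sq W_def[symmetric] divide_simps)
qed

text \<open>For angles A, B, C the identity makes cos A + cos (B + C) positive, hence A < |pi - (B +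
  C)|. So either A + B + C < pi or B + C > pi + A. If the sum were at least pi, the second
  alternative would hold for every angle, and adding two of these would give an angle above pi. The
  identity later also measures how fast the defect vanishes.\<close>

lemma tri_angle_sum:
  assumes "1 < x" "1 < y" "1 < z" "0 < tri_det x y z"
  shows "tri_angle x y z + tri_angle y x z + tri_angle z x y < pi"
    and "cos (tri_angle x y z) + cos (tri_angle y x z + tri_angle z x y)
       = tri_det x y z / ((x + 1) * (sqrt (y\<^sup>2 - 1) * sqrt (z\<^sup>2 - 1)))"
proof -
  have *: "cos (tri_angle x y z) + cos (tri_angle y x z + tri_angle z x y)
       = tri_det x y z / ((x + 1) * (sqrt (y\<^sup>2 - 1) * sqrt (z\<^sup>2 - 1)))"
    if "1 < x" "1 < y" "1 < z" "0 < tri_det x y z" for x y z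
  proof -
    have p: "tri_det y x z = tri_det x y z" "tri_det z x y = tri_det x y z"
      by (simp_all add: tri_det_def algebra_simps)
    define X where "X = sqrt (x\<^sup>2 - 1)"
    define Y where "Y = sqrt (y\<^sup>2 - 1)"
    define Z where "Z = sqrt (z\<^sup>2 - 1)"
    define W where "W = sqrt (tri_det x y z)"
    have pos: "0 < x\<^sup>2 - 1" "0 < y\<^sup>2 - 1" "0 < z\<^sup>2 - 1"
      using that by (auto intro!: square_gt_1)
    have XYZ: "0 < X" "0 < Y" "0 < Z" "0 < W"
      using pos that by (auto simp: X_def Y_def Z_def W_def)
    have sq: "X\<^sup>2 = (x - 1) * (x + 1)" "W\<^sup>2 = tri_det x y z"
      using pos that by (auto simp: X_def W_def algebra_simps power2_eq_square)
    have "cos (tri_angle x y z) + cos (tri_angle y x z + tri_angle z x y)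
       = (y * z - x) / (Y * Z) + (x * z - y) / (X * Z) * ((x * y - z) / (X * Y))
         - W / (X * Z) * (W / (X * Y))"
      using that p
      by (simp add: cos_add cos_tri_angle sin_tri_angle tri_cos_def X_def Y_def Z_def W_def)
    also have "\<dots> = ((y * z - x) * X\<^sup>2 + (x * z - y) * (x * y - z) - W\<^sup>2) / (X\<^sup>2 * (Y * Z))"
      using XYZ by (simp add: divide_simps power2_eq_square)
    also have "(y * z - x) * X\<^sup>2 + (x * z - y) * (x * y - z) - W\<^sup>2 = (x - 1) * tri_det x y z"
      unfolding sq by (simp add: tri_det_def algebra_simps power2_eq_square)
    also have "\<dots> / (X\<^sup>2 * (Y * Z)) = tri_det x y z / ((x + 1) * (Y * Z))"
      unfolding sq using that by simp
    finally show ?thesis by (simp add: Y_def Z_def)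
  qed
  show "cos (tri_angle x y z) + cos (tri_angle y x z + tri_angle z x y)
       = tri_det x y z / ((x + 1) * (sqrt (y\<^sup>2 - 1) * sqrt (z\<^sup>2 - 1)))"
    using *[OF assms] .
  have alt: "tri_angle y x z + tri_angle z x y < pi - tri_angle x y z
     \<or> tri_angle y x z + tri_angle z x y > pi + tri_angle x y z"
    if "1 < x" "1 < y" "1 < z" "0 < tri_det x y z" for x y z
  proof -
    define b where "b = tri_angle y x z + tri_angle z x y"
    define a where "a = tri_angle x y z"
    have p: "tri_det y x z = tri_det x y z" "tri_det z x y = tri_det x y z"
      by (simp_all add: tri_det_def algebra_simps)
    have b: "0 < b" "b < 2 * pi" "0 < a" "a < pi"
      using that p tri_angle_bounds[of x z y] tri_angle_bounds[of x y z] tri_angle_bounds[of y z x]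
      by (auto simp: b_def a_def)
    have "0 < cos a + cos b"
      unfolding a_def b_def *[OF that] using that square_gt_1[of y] square_gt_1[of z] by simp
    then have "cos \<bar>pi - b\<bar> < cos a" by (simp add: cos_diff)
    then have "a < \<bar>pi - b\<bar>"
      using b by (subst (asm) cos_mono_less_eq) auto
    then show ?thesis unfolding a_def b_def by linarith
  qed
  have p: "tri_det y x z = tri_det x y z" "tri_det z x y = tri_det x y z"
    by (simp_all add: tri_det_def algebra_simps)
  have c: "tri_angle u v w = tri_angle u w v" for u v w
    by (simp add: tri_angle_def tri_cos_def mult.commute)
  show "tri_angle x y z + tri_angle y x z + tri_angle z x y < pi"
    using alt[OF assms] alt[of y x z, unfolded p, OF assms(2,1,3,4)]
      alt[of z x y, unfolded p, OF assms(3,1,2,4)]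
      tri_angle_bounds(2)[OF assms(2,3,4)] tri_angle_bounds(2)[of x z y, unfolded p, OF assms(1,3,4)]
      tri_angle_bounds(2)[of x y z, unfolded p, OF assms(1,2,4)]
    unfolding c[of x z y] c[of y z x] c[of z y x] by linarith
qed

section \<open>Triangles of centers of three disks\<close>

text \<open>The value -1 is excluded because Theta stays below pi; it would let the centers of two
  equal disks coincide. The value 1 is tangency.\<close>

definition c1_cosines :: "real \<Rightarrow> real \<Rightarrow> real \<Rightarrow> bool" where
  "c1_cosines p q s \<longleftrightarrow> -1 < p \<and> p \<le> 1 \<and> -1 < q \<and> q \<le> 1 \<and> -1 < s \<and> s \<le> 1 \<and>
     0 \<le> p + q * s \<and> 0 \<le> q + p * s \<and> 0 \<le> s + p * q"

lemma c1_cosines_swap: "c1_cosines p q s \<Longrightarrow> c1_cosines q p s" "c1_cosines p q s \<Longrightarrow> c1_cosines s q p"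
  "c1_cosines p q s \<Longrightarrow> c1_cosines p s q"
  by (auto simp: c1_cosines_def mult_ac)

definition disk_cosh :: "real \<Rightarrow> real \<Rightarrow> real \<Rightarrow> real" where
  "disk_cosh a b i = cosh a * cosh b + sinh a * sinh b * i"

text \<open>For disks of radii \<open>a\<close>, \<open>b\<close>, \<open>c\<close>, the numbers \<open>p\<close>, \<open>q\<close>, \<open>s\<close> are the cosines of the exterior
  intersection angles of the pairs \<open>bc\<close>, \<open>ac\<close>, \<open>ab\<close>; the angle is the one at the disk of radius \<open>a\<close>.\<close>

definition disk_angle :: "real \<Rightarrow> real \<Rightarrow> real \<Rightarrow> real \<Rightarrow> real \<Rightarrow> real \<Rightarrow> real" where
  "disk_angle p q s a b c = tri_angle (disk_cosh b c p) (disk_cosh a c q) (disk_cosh a b s)"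

lemma disk_cosh_commute: "disk_cosh a b i = disk_cosh b a i"
  by (simp add: disk_cosh_def mult_ac)

lemma tri_angle_commute: "tri_angle x y z = tri_angle x z y"
  by (simp add: tri_angle_def tri_cos_def mult.commute)

lemma disk_angle_commute: "disk_angle p q s a b c = disk_angle p s q a c b"
  unfolding disk_angle_def by (subst tri_angle_commute) (simp add: disk_cosh_commute)

lemma disk_cosh_gt_1:
  assumes "0 < a" "0 < b" "-1 < i"
  shows "1 < disk_cosh a b i"
proof -
  have "sinh a * sinh b * (-1) < sinh a * sinh b * i"
    using assms by (intro mult_strict_left_mono) auto
  then have "cosh (a - b) < disk_cosh a b i"
    by (simp add: disk_cosh_def cosh_diff)
  then show ?thesis using cosh_real_ge_1[of "a - b"] by linarith
qed

lemma c1_cosines_nonneg: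
  assumes "c1_cosines p q s"
  shows "0 \<le> p + q * s" "0 \<le> q + p * s" "0 \<le> s + p * q" "0 \<le> 1 - p\<^sup>2" "0 \<le> 1 - q\<^sup>2" "0 \<le> 1 - s\<^sup>2"
  using assms by (auto simp: c1_cosines_def abs_le_iff abs_square_le_1)

text \<open>The terms are grouped so that each is visibly nonnegative; (C1) supplies the signs of
  the mixed factors \<open>s + p * q\<close>, \<open>q + p * s\<close> and
  \<open>p + q * s\<close>.\<close>

lemma tri_det_disks:
  "tri_det (disk_cosh b c p) (disk_cosh a c q) (disk_cosh a b s) =
     (sinh b)\<^sup>2 * (sinh c)\<^sup>2 * (1 - p\<^sup>2) + (sinh a)\<^sup>2 * (sinh c)\<^sup>2 * (1 - q\<^sup>2) + (sinh a)\<^sup>2 * (sinh b)\<^sup>2 * (1 - s\<^sup>2)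
     + 2 * (cosh a * cosh b * sinh a * sinh b * (sinh c)\<^sup>2 * (s + p * q)
          + cosh a * cosh c * sinh a * sinh c * (sinh b)\<^sup>2 * (q + p * s)
          + cosh b * cosh c * sinh b * sinh c * (sinh a)\<^sup>2 * (p + q * s))
     + 2 * (sinh a)\<^sup>2 * (sinh b)\<^sup>2 * (sinh c)\<^sup>2 * (1 + p * q * s)"
  using cosh_square_eq[of a] cosh_square_eq[of b] cosh_square_eq[of c]
  unfolding tri_det_def disk_cosh_def by algebra

text \<open>Strictness is taken from the last term of the expansion: a product of three numbers in
  (-1, 1] is never -1.\<close>

lemma tri_det_disks_pos:
  assumes "c1_cosines p q s" "0 < a" "0 < b" "0 < c"
  shows "0 < tri_det (disk_cosh b c p) (disk_cosh a c q) (disk_cosh a b s)"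
proof -
  have "-1 < p * q * s"
  proof -
    have "\<bar>p * q\<bar> * \<bar>s\<bar> \<le> 1 * \<bar>s\<bar>" 
      using assms(1) by (intro mult_right_mono) (auto simp: c1_cosines_def abs_mult intro!: mult_le_one)
    then have "\<bar>p * q * s\<bar> \<le> \<bar>s\<bar>" by (simp add: abs_mult)
    moreover have "\<bar>p * q\<bar> \<le> 1"
      using assms(1) by (auto simp: c1_cosines_def abs_mult intro!: mult_le_one)
    moreover have "p * q \<noteq> -1" 
    proof
      assume e: "p * q = -1"
      have "\<bar>p\<bar> \<le> 1" "\<bar>q\<bar> \<le> 1" using assms(1) by (auto simp: c1_cosines_def)
      moreover have "\<bar>p\<bar> * \<bar>q\<bar> = 1" using e by (simp flip: abs_mult)
      moreover have "\<bar>p\<bar> * \<bar>q\<bar> \<le> \<bar>p\<bar>" "\<bar>p\<bar> * \<bar>q\<bar> \<le> \<bar>q\<bar>"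
        using calculation(1,2) by (auto intro: mult_left_le mult_left_le_one_le)
      ultimately have "\<bar>p\<bar> = 1" "\<bar>q\<bar> = 1" by linarith+
      then have "p = 1" "q = 1" using assms(1) by (auto simp: c1_cosines_def)
      then show False using e by simp
    qed
    moreover have "-1 < s" "s \<le> 1" using assms(1) by (auto simp: c1_cosines_def)
    ultimately show ?thesis
      by (cases "s = 1") auto
  qed
  then have pos: "0 < 2 * (sinh a)\<^sup>2 * (sinh b)\<^sup>2 * (sinh c)\<^sup>2 * (1 + p * q * s)"
    using assms by (intro mult_pos_pos) auto
  show ?thesis
    unfolding tri_det_disks
    by (rule add_nonneg_pos pos c1_cosines_nonneg[OF assms(1)] add_nonneg_nonneg mult_nonneg_nonneg
        | use assms in simp)+
qed

text \<open>Up to a positive factor, the derivative in \<open>b\<close> of the angle at the disk of radius \<open>a\<close>; the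
  factors \<open>p + q * s\<close> and \<open>q + p * s\<close> are where (C1) enters.\<close>

definition disk_flux :: "real \<Rightarrow> real \<Rightarrow> real \<Rightarrow> real \<Rightarrow> real \<Rightarrow> real \<Rightarrow> real" where
  "disk_flux p q s a b c = (sinh a)\<^sup>2 * (cosh b * sinh c * (p + q * s) + cosh c * sinh b * (1 - s\<^sup>2))
     + cosh a * sinh a * sinh b * sinh c * (q + p * s)"

lemma disk_flux_nonneg:
  assumes "c1_cosines p q s" "0 < a" "0 < b" "0 < c"
  shows "0 \<le> disk_flux p q s a b c"
  unfolding disk_flux_def
  by (rule c1_cosines_nonneg[OF assms(1)] add_nonneg_nonneg mult_nonneg_nonneg | use assms in simp)+

text \<open>A vanishing first flux forces \<open>s = 1\<close> and \<open>q + p * s = 0\<close>; a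
  vanishing second one forces \<open>p = 1\<close>. Together they give \<open>q = -1\<close>, which
  is excluded. So changing \<open>b\<close> moves at least one of the two other angles, and this
  makes the drop of the angle sum strict.\<close>

lemma disk_flux_pos:
  assumes "c1_cosines p q s" "0 < a" "0 < b" "0 < c"
  shows "0 < disk_flux p q s a b c \<or> 0 < disk_flux s q p c b a"
proof (rule ccontr)
  assume "\<not> ?thesis"
  then have z: "disk_flux p q s a b c = 0" "disk_flux s q p c b a = 0"
    using disk_flux_nonneg[OF assms] disk_flux_nonneg[of s q p c b a] assms c1_cosines_swap(2)
    by fastforce+
  have aux: "s = 1 \<and> q + p * s = 0"
    if "c1_cosines p q s" "0 < a" "0 < b" "0 < c" "disk_flux p q s a b c = 0" for p q s a b c :: real
  proof -
    have nn: "0 \<le> p + q * s" "0 \<le> q + p * s" "0 \<le> 1 - s\<^sup>2" "-1 < s"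
      using that c1_cosines_nonneg[OF that(1)] by (auto simp: c1_cosines_def)
    have "0 \<le> (sinh a)\<^sup>2 * (cosh b * sinh c * (p + q * s))"
      "0 \<le> (sinh a)\<^sup>2 * (cosh c * sinh b * (1 - s\<^sup>2))"
      "0 \<le> cosh a * sinh a * sinh b * sinh c * (q + p * s)"
      using nn that by (intro mult_nonneg_nonneg; simp)+
    with that(5) have "(sinh a)\<^sup>2 * (cosh c * sinh b * (1 - s\<^sup>2)) = 0"
      "cosh a * sinh a * sinh b * sinh c * (q + p * s) = 0"
      unfolding disk_flux_def by (simp_all only: distrib_left)
    then have "1 - s\<^sup>2 = 0" "q + p * s = 0" using that by auto
    moreover have "s = 1" using calculation(1) nn(4) by (auto simp: power2_eq_1_iff)
    ultimately show ?thesis by simp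
  qed
  from aux[OF assms z(1)] aux[OF c1_cosines_swap(2)[OF assms(1)] assms(4,3,2) z(2)] assms(1)
  show False by (auto simp: c1_cosines_def)
qed

text \<open>\<open>x'\<close> and \<open>z'\<close> are the derivatives in \<open>b\<close> of the
  two sides meeting at the moving disk. The right-hand sides are the numerators that differentiation
  yields; \<open>disk_flux\<close> is the form in which their sign is visible.\<close>

lemma disk_flux_eq:
  fixes p q s a b c :: real
  defines "x \<equiv> disk_cosh b c p" and "y \<equiv> disk_cosh a c q" and "z \<equiv> disk_cosh a b s"
    and "x' \<equiv> sinh b * cosh c + cosh b * sinh c * p" and "z' \<equiv> cosh a * sinh b + sinh a * cosh b * s"
  shows "disk_flux p q s a b c = x' * (z\<^sup>2 - 1) - z' * (x * z - y)"
    and "disk_flux s q p c b a = z' * (x\<^sup>2 - 1) - x' * (x * z - y)"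
  using cosh_square_eq[of a] cosh_square_eq[of b] cosh_square_eq[of c]
  unfolding disk_flux_def disk_cosh_def x_def y_def z_def x'_def z'_def by algebra+

lemma DERIV_disk_cosh1: "((\<lambda>b. disk_cosh b c p) has_real_derivative sinh b * cosh c + cosh b * sinh c * p) (at b)"
  unfolding disk_cosh_def by (auto intro!: derivative_eq_intros)

lemma DERIV_disk_cosh2: "((\<lambda>b. disk_cosh a b s) has_real_derivative cosh a * sinh b + sinh a * cosh b * s) (at b)"
  unfolding disk_cosh_def by (auto intro!: derivative_eq_intros)

section \<open>Dependence of the three angles on one radius\<close>

context
  fixes p q s a c :: real
  assumes c1: "c1_cosines p q s" and ac: "0 < a" "0 < c"
begin

lemma disks_gt_1:
  assumes "0 < b"
  shows "1 < disk_cosh b c p" "1 < disk_cosh a c q" "1 < disk_cosh a b s"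
  using c1 ac assms by (auto intro!: disk_cosh_gt_1 simp: c1_cosines_def)

lemma DERIV_disk_angle:
  assumes b: "0 < b"
  shows "((\<lambda>b. disk_angle p q s a b c) has_real_derivative
     disk_flux p q s a b c / (((disk_cosh a b s)\<^sup>2 - 1) *
       sqrt (tri_det (disk_cosh b c p) (disk_cosh a c q) (disk_cosh a b s)))) (at b)"
proof -
  have e: "(u - 0 * k / l - v * m / d) / W = (u * d - v * m) / (d * W)" if "0 < d" for u k l v m d W :: real
    using that by (simp add: diff_divide_distrib)
  show ?thesis
    unfolding disk_angle_def disk_flux_eq(1)
    by (rule DERIV_cong[OF DERIV_tri_angle[OF DERIV_disk_cosh1 DERIV_const DERIV_disk_cosh2] e])
       (use disks_gt_1[OF b] tri_det_disks_pos[OF c1 ac(1) b ac(2)] square_gt_1 in auto)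
qed

text \<open>The angle at \<open>b\<close> falls at \<open>z\<close> times the rate at which the
  angle at \<open>a\<close> grows plus \<open>x\<close> times that at \<open>c\<close>, where
  \<open>x\<close> and \<open>z\<close> are the hyperbolic cosines of the adjacent sides. Since
  these exceed 1, the sum falls; the denominators arise from
  \<open>(1 - z) / (z^2 - 1) = - 1 / (z + 1)\<close>.\<close>

lemma DERIV_sum_disk_angle:
  assumes b: "0 < b"
  shows "((\<lambda>b. disk_angle p q s a b c + disk_angle q p s b a c + disk_angle s p q c a b) has_real_derivative
     - (disk_flux p q s a b c / (disk_cosh a b s + 1) + disk_flux s q p c b a / (disk_cosh b c p + 1)) /
       sqrt (tri_det (disk_cosh b c p) (disk_cosh a c q) (disk_cosh a b s))) (at b)"
proof -
  define x where "x = disk_cosh b c p"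
  define y where "y = disk_cosh a c q"
  define z where "z = disk_cosh a b s"
  define x' where "x' = sinh b * cosh c + cosh b * sinh c * p"
  define z' where "z' = cosh a * sinh b + sinh a * cosh b * s"
  define W where "W = sqrt (tri_det x y z)"
  have gt: "1 < x" "1 < y" "1 < z" using disks_gt_1[OF b] by (auto simp: x_def y_def z_def)
  have sq: "x\<^sup>2 - 1 = (x - 1) * (x + 1)" "z\<^sup>2 - 1 = (z - 1) * (z + 1)"
    by (auto simp: algebra_simps power2_eq_square)
  have det: "0 < tri_det x y z"
    unfolding x_def y_def z_def using tri_det_disks_pos[OF c1 ac(1) b ac(2)] .
  have p: "tri_det y x z = tri_det x y z" "tri_det z x y = tri_det x y z"
    by (simp_all add: tri_det_def algebra_simps)
  have W: "0 < W" using det by (simp add: W_def)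
  have d1: "((\<lambda>b. disk_angle p q s a b c) has_real_derivative
     (x' - 0 * (x * y - z) / (y\<^sup>2 - 1) - z' * (x * z - y) / (z\<^sup>2 - 1)) / W) (at b)"
    unfolding disk_angle_def x_def y_def z_def x'_def z'_def W_def using gt det
    by (intro DERIV_tri_angle DERIV_disk_cosh1 DERIV_const DERIV_disk_cosh2)
       (simp_all add: x_def y_def z_def)
  have d2: "((\<lambda>b. disk_angle q p s b a c) has_real_derivative
     (0 - x' * (y * x - z) / (x\<^sup>2 - 1) - z' * (y * z - x) / (z\<^sup>2 - 1)) / W) (at b)"
    unfolding disk_angle_def x_def y_def z_def x'_def z'_def W_def disk_cosh_commute[of _ a] 
      p[unfolded x_def y_def z_def, symmetric] using gt det
    by (intro DERIV_tri_angle DERIV_disk_cosh1 DERIV_const DERIV_disk_cosh2)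
       (simp_all add: x_def y_def z_def p[unfolded x_def y_def z_def])
  have d3: "((\<lambda>b. disk_angle s p q c a b) has_real_derivative
     (z' - x' * (z * x - y) / (x\<^sup>2 - 1) - 0 * (z * y - x) / (y\<^sup>2 - 1)) / W) (at b)"
    unfolding disk_angle_def x_def y_def z_def x'_def z'_def W_def disk_cosh_commute[of c]
      p(2)[unfolded x_def y_def z_def, symmetric] using gt det
    by (intro DERIV_tri_angle DERIV_disk_cosh1 DERIV_const DERIV_disk_cosh2)
       (simp_all add: x_def y_def z_def p[unfolded x_def y_def z_def])
  have e: "(x' - 0 * (x * y - z) / (y\<^sup>2 - 1) - z' * (x * z - y) / (z\<^sup>2 - 1)) / W
     + (0 - x' * (y * x - z) / (x\<^sup>2 - 1) - z' * (y * z - x) / (z\<^sup>2 - 1)) / W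
     + (z' - x' * (z * x - y) / (x\<^sup>2 - 1) - 0 * (z * y - x) / (y\<^sup>2 - 1)) / W
     = - ((x' * (z\<^sup>2 - 1) - z' * (x * z - y)) / (z + 1) + (z' * (x\<^sup>2 - 1) - x' * (x * z - y)) / (x + 1)) / W"
    using gt W unfolding sq
    by (simp add: divide_simps) (simp add: algebra_simps)
  show ?thesis
    by (rule DERIV_cong[OF DERIV_add[OF DERIV_add[OF d1 d2] d3]])
       (unfold e disk_flux_eq(1)[of p q s a b c] disk_flux_eq(2)[of s q p c b a], simp add: x_def y_def z_def x'_def z'_def W_def)
qed

lemma disk_angle_mono:
  assumes "0 < b" "b \<le> b'"
  shows "disk_angle p q s a b c \<le> disk_angle p q s a b' c"
proof (rule DERIV_nonneg_imp_nondecreasing[OF assms(2)], intro exI conjI)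
  fix t assume "b \<le> t" "t \<le> b'"
  with assms have t: "0 < t" by simp
  show "((\<lambda>b. disk_angle p q s a b c) has_real_derivative
     disk_flux p q s a t c / (((disk_cosh a t s)\<^sup>2 - 1) *
       sqrt (tri_det (disk_cosh t c p) (disk_cosh a c q) (disk_cosh a t s)))) (at t)"
    by (rule DERIV_disk_angle[OF t])
  show "0 \<le> disk_flux p q s a t c / (((disk_cosh a t s)\<^sup>2 - 1) *
       sqrt (tri_det (disk_cosh t c p) (disk_cosh a c q) (disk_cosh a t s)))"
    using disk_flux_nonneg[OF c1 ac(1) t ac(2)] square_gt_1[OF disks_gt_1(3)[OF t]]
      tri_det_disks_pos[OF c1 ac(1) t ac(2)] by simp
qed

lemma sum_disk_angle_strict:
  assumes "0 < b" "b < b'"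
  shows "disk_angle p q s a b' c + disk_angle q p s b' a c + disk_angle s p q c a b'
    < disk_angle p q s a b c + disk_angle q p s b a c + disk_angle s p q c a b"
proof (rule DERIV_neg_imp_decreasing[OF assms(2)], intro exI conjI)
  fix t assume "b \<le> t" "t \<le> b'"
  with assms have t: "0 < t" by simp
  show "((\<lambda>b. disk_angle p q s a b c + disk_angle q p s b a c + disk_angle s p q c a b) has_real_derivative
     - (disk_flux p q s a t c / (disk_cosh a t s + 1) + disk_flux s q p c t a / (disk_cosh t c p + 1)) /
       sqrt (tri_det (disk_cosh t c p) (disk_cosh a c q) (disk_cosh a t s))) (at t)"
    by (rule DERIV_sum_disk_angle[OF t])
  have "0 \<le> disk_flux p q s a t c" "0 \<le> disk_flux s q p c t a"
    using disk_flux_nonneg c1 c1_cosines_swap(2) ac t by blast+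
  moreover have "0 < disk_flux p q s a t c \<or> 0 < disk_flux s q p c t a"
    using disk_flux_pos c1 ac t by blast
  ultimately have "0 < disk_flux p q s a t c / (disk_cosh a t s + 1) + disk_flux s q p c t a / (disk_cosh t c p + 1)"
    using disks_gt_1[OF t] by (auto intro: add_pos_nonneg add_nonneg_pos)
  then show "- (disk_flux p q s a t c / (disk_cosh a t s + 1) + disk_flux s q p c t a / (disk_cosh t c p + 1)) /
       sqrt (tri_det (disk_cosh t c p) (disk_cosh a c q) (disk_cosh a t s)) < 0"
    using tri_det_disks_pos[OF c1 ac(1) t ac(2)] by (simp add: divide_neg_pos)
qed

end

section \<open>Limits of the angles\<close>

lemma tendsto_tri_angle_arccos:
  assumes "((\<lambda>n. tri_cos (x n) (y n) (z n)) \<longlongrightarrow> l) F" "F \<noteq> bot"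
    and "\<forall>\<^sub>F n in F. 1 < y n \<and> 1 < z n \<and> 0 < tri_det (x n) (y n) (z n)"
  shows "((\<lambda>n. tri_angle (x n) (y n) (z n)) \<longlongrightarrow> arccos l) F"
proof -
  have ev: "\<forall>\<^sub>F n in F. tri_cos (x n) (y n) (z n) \<in> {-1..1}"
    using assms(3) by eventually_elim (use tri_cos_bounds in \<open>auto intro: less_imp_le\<close>)
  have "-1 \<le> l" "l \<le> 1"
    using assms(1,2) ev by (auto intro!: tendsto_lowerbound[OF assms(1)] tendsto_upperbound[OF assms(1)]
      elim: eventually_mono)
  then show ?thesis
    unfolding tri_angle_def
    by (intro continuous_on_tendsto_compose[OF continuous_on_arccos' assms(1) _ ev]) auto
qed

lemma tendsto_tri_cos:
  assumes "(x \<longlongrightarrow> x0) F" "(y \<longlongrightarrow> y0) F" "(z \<longlongrightarrow> z0) F" "1 < y0" "1 < z0"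
  shows "((\<lambda>n. tri_cos (x n) (y n) (z n)) \<longlongrightarrow> tri_cos x0 y0 z0) F"
  unfolding tri_cos_def using square_gt_1[OF assms(4)] square_gt_1[OF assms(5)]
  by (intro tendsto_intros assms) auto

lemma tendsto_disk_cosh:
  assumes "(a \<longlongrightarrow> a0) F" "(b \<longlongrightarrow> b0) F"
  shows "((\<lambda>n. disk_cosh (a n) (b n) i) \<longlongrightarrow> disk_cosh a0 b0 i) F"
  unfolding disk_cosh_def by (intro tendsto_intros assms)

text \<open>Only the two sides enclosing the angle must keep positive length. The limit triangle may
  be degenerate, as when \<open>a0 = 0\<close> with \<open>b0\<close> and \<open>c0\<close>
  positive, or \<open>b0 = c0 = 0\<close> with \<open>a0\<close> positive.\<close>

lemma tendsto_disk_angle: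
  assumes lim: "(a \<longlongrightarrow> a0) F" "(b \<longlongrightarrow> b0) F" "(c \<longlongrightarrow> c0) F" and F: "F \<noteq> bot"
    and pos: "\<forall>\<^sub>F n in F. 0 < a n \<and> 0 < b n \<and> 0 < c n"
    and c1: "c1_cosines p q s"
    and nondeg: "1 < disk_cosh a0 c0 q" "1 < disk_cosh a0 b0 s"
  shows "((\<lambda>n. disk_angle p q s (a n) (b n) (c n)) \<longlongrightarrow> disk_angle p q s a0 b0 c0) F"
  unfolding disk_angle_def tri_angle_def[of "disk_cosh b0 c0 p"]
proof (rule tendsto_tri_angle_arccos[OF tendsto_tri_cos[OF tendsto_disk_cosh tendsto_disk_cosh tendsto_disk_cosh]])
  show "\<forall>\<^sub>F n in F. 1 < disk_cosh (a n) (c n) q \<and> 1 < disk_cosh (a n) (b n) s \<and>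
      0 < tri_det (disk_cosh (b n) (c n) p) (disk_cosh (a n) (c n) q) (disk_cosh (a n) (b n) s)"
    using pos by eventually_elim (use c1 tri_det_disks_pos disks_gt_1 in auto)
qed (use assms in auto)

text \<open>Neither \<open>u\<close> nor \<open>v\<close> need converge, and the cosine is flat at 0
  and \<open>pi\<close>, so a bound uniform in both is required: cos u - cos v = 2 sin m sin h is at
  least 2 (sin h)^2.\<close>

lemma tendsto_angle_defect_0:
  fixes u v :: "'a \<Rightarrow> real"
  assumes "\<forall>\<^sub>F n in F. 0 \<le> u n \<and> u n \<le> v n \<and> v n \<le> pi"
    and "((\<lambda>n. cos (u n) - cos (v n)) \<longlongrightarrow> 0) F"
  shows "((\<lambda>n. v n - u n) \<longlongrightarrow> 0) F"
proof -
  have ev: "\<forall>\<^sub>F n in F. 0 \<le> sin ((v n - u n) / 2) \<and> 2 * (sin ((v n - u n) / 2))\<^sup>2 \<le> cos (u n) - cos (v n)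
     \<and> 0 \<le> (v n - u n) / 2 \<and> (v n - u n) / 2 \<le> pi / 2"
    using assms(1)
  proof eventually_elim
    case (elim n)
    define h where "h = (v n - u n) / 2"
    define m where "m = (u n + v n) / 2"
    \<comment> \<open>The last two bounds are \<open>0 \<le> u n\<close> and
      \<open>v n \<le> pi\<close> rewritten; they place \<open>m\<close> at least as close to
      \<open>pi / 2\<close> as \<open>h\<close>.\<close>
    have h: "0 \<le> h" "h \<le> pi / 2" "h \<le> m" "m \<le> pi - h" using elim by (auto simp: h_def m_def field_simps)
    have "sin h \<le> sin m"
    proof (cases "m \<le> pi / 2")
      case True
      then show ?thesis using h by (intro sin_monotone_2pi_le) auto
    next
      case False
      then have "sin h \<le> sin (pi - m)" using h by (intro sin_monotone_2pi_le) auto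
      then show ?thesis by simp
    qed
    moreover have "0 \<le> sin h" using h by (intro sin_ge_zero) auto
    ultimately have "2 * (sin h)\<^sup>2 \<le> 2 * sin m * sin h"
      by (simp add: power2_eq_square mult_right_mono)
    also have "\<dots> = cos (u n) - cos (v n)"
      by (simp add: cos_diff_cos m_def h_def)
    finally show ?case using \<open>0 \<le> sin h\<close> h by (simp add: h_def)
  qed
  have "((\<lambda>n. 2 * (sin ((v n - u n) / 2))\<^sup>2) \<longlongrightarrow> 0) F"
    by (rule tendsto_sandwich[OF _ _ tendsto_const assms(2)]) (use ev in \<open>auto elim: eventually_mono\<close>)
  then have "((\<lambda>n. sqrt (2 * (sin ((v n - u n) / 2))\<^sup>2 / 2)) \<longlongrightarrow> sqrt (0 / 2)) F"
    by (intro tendsto_intros) auto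
  then have "((\<lambda>n. \<bar>sin ((v n - u n) / 2)\<bar>) \<longlongrightarrow> 0) F"
    by simp
  then have "((\<lambda>n. sin ((v n - u n) / 2)) \<longlongrightarrow> 0) F"
    by (simp add: tendsto_rabs_zero_iff)
  then have "((\<lambda>n. 2 * arcsin (sin ((v n - u n) / 2))) \<longlongrightarrow> 2 * arcsin 0) F"
    by (intro tendsto_mult tendsto_const continuous_on_tendsto_compose[OF continuous_on_arcsin']) auto
  moreover have "\<forall>\<^sub>F n in F. 2 * arcsin (sin ((v n - u n) / 2)) = v n - u n"
    using ev by eventually_elim (simp add: arcsin_sin)
  ultimately show ?thesis
    by (auto dest: Lim_transform_eventually)
qed

text \<open>The cosine identity of \<open>tri_angle_sum\<close> bounds the difference of the cosines
  of \<open>u\<close> and \<open>v\<close> by \<open>Y * Z\<close>, and \<open>Z\<close> tends to 0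
  because the side between the two shrinking disks collapses. The value of \<open>c0\<close> does
  not matter, so this also covers three shrinking disks.\<close>

lemma tendsto_sum_disk_angle_pi:
  assumes lim: "(a \<longlongrightarrow> 0) F" "(b \<longlongrightarrow> 0) F" "(c \<longlongrightarrow> c0) F"
    and pos: "\<forall>\<^sub>F n in F. 0 < a n \<and> 0 < b n \<and> 0 < c n"
    and c1: "c1_cosines p q s"
  shows "((\<lambda>n. disk_angle p q s (a n) (b n) (c n) + disk_angle q p s (b n) (a n) (c n)
      + disk_angle s p q (c n) (a n) (b n)) \<longlongrightarrow> pi) F"
proof -
  define x where "x n = disk_cosh (b n) (c n) p" for n
  define y where "y n = disk_cosh (a n) (c n) q" for n
  define z where "z n = disk_cosh (a n) (b n) s" for n
  define u where "u n = disk_angle p q s (a n) (b n) (c n)" for n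
  define v where "v n = pi - (disk_angle q p s (b n) (a n) (c n) + disk_angle s p q (c n) (a n) (b n))" for n
  have u: "u n = tri_angle (x n) (y n) (z n)" for n
    by (simp add: u_def disk_angle_def x_def y_def z_def)
  have v: "v n = pi - (tri_angle (y n) (x n) (z n) + tri_angle (z n) (x n) (y n))" for n
    by (simp add: v_def disk_angle_def x_def y_def z_def disk_cosh_commute)
  have p: "tri_det (y n) (x n) (z n) = tri_det (x n) (y n) (z n)"
      "tri_det (z n) (x n) (y n) = tri_det (x n) (y n) (z n)" for n
    by (simp_all add: tri_det_def algebra_simps)
  have ev: "\<forall>\<^sub>F n in F. 0 \<le> u n \<and> u n \<le> v n \<and> v n \<le> pi \<and> 0 \<le> cos (u n) - cos (v n)
    \<and> cos (u n) - cos (v n) \<le> sqrt ((y n)\<^sup>2 - 1) * sqrt ((z n)\<^sup>2 - 1)"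
    using pos
  proof eventually_elim
    case (elim n)
    then have g: "1 < x n" "1 < y n" "1 < z n" and d: "0 < tri_det (x n) (y n) (z n)"
      using disks_gt_1[OF c1, of "a n" "c n" "b n"] tri_det_disks_pos[OF c1, of "a n" "b n" "c n"]
      by (auto simp: x_def y_def z_def)
    define Y where "Y = sqrt ((y n)\<^sup>2 - 1)"
    define Z where "Z = sqrt ((z n)\<^sup>2 - 1)"
    have YZ: "0 < Y" "0 < Z" "Y\<^sup>2 = (y n)\<^sup>2 - 1" "Z\<^sup>2 = (z n)\<^sup>2 - 1"
      using square_gt_1[OF g(2)] square_gt_1[OF g(3)] by (auto simp: Y_def Z_def)
    have "cos (u n) - cos (v n) = tri_det (x n) (y n) (z n) / ((x n + 1) * (Y * Z))"
      using tri_angle_sum(2)[OF g d] by (simp add: u v Y_def Z_def)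
    moreover have "0 \<le> tri_det (x n) (y n) (z n) / ((x n + 1) * (Y * Z))"
      using d g YZ by simp
    \<comment> \<open>The determinant is the squared sine times \<open>Y^2 * Z^2\<close>, and the
      squared sine is at most 1.\<close>
    moreover have "tri_det (x n) (y n) (z n) / ((x n + 1) * (Y * Z)) \<le> Y * Z"
    proof -
      have "tri_det (x n) (y n) (z n) / (Y\<^sup>2 * Z\<^sup>2) \<le> 1"
        unfolding YZ one_minus_tri_cos_square[OF g(2,3), symmetric] by simp
      then have "tri_det (x n) (y n) (z n) \<le> (Y * Z) * (Y * Z)"
        using YZ(1,2) by (simp add: divide_simps power2_eq_square mult_ac)
      also have "\<dots> \<le> (Y * Z) * ((x n + 1) * (Y * Z))"
        using YZ(1,2) g by (intro mult_left_mono) auto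
      finally show ?thesis using YZ(1,2) g by (simp add: divide_simps)
    qed
    moreover have "0 < tri_angle (x n) (y n) (z n)" "0 < tri_angle (y n) (x n) (z n)"
      "0 < tri_angle (z n) (x n) (y n)"
      using g d by (auto intro!: tri_angle_bounds simp: p)
    then have "0 \<le> u n" "u n \<le> v n" "v n \<le> pi"
      using tri_angle_sum(1)[OF g d] unfolding u v by linarith+
    ultimately show ?case by (simp add: Y_def Z_def)
  qed
  have "((\<lambda>n. sqrt ((y n)\<^sup>2 - 1) * sqrt ((z n)\<^sup>2 - 1)) \<longlongrightarrow>
      sqrt ((disk_cosh 0 c0 q)\<^sup>2 - 1) * sqrt ((disk_cosh 0 0 s)\<^sup>2 - 1)) F"
    unfolding y_def z_def by (intro tendsto_intros tendsto_disk_cosh lim)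
  then have lim0: "((\<lambda>n. sqrt ((y n)\<^sup>2 - 1) * sqrt ((z n)\<^sup>2 - 1)) \<longlongrightarrow> 0) F"
    by (simp add: disk_cosh_def)
  have "\<forall>\<^sub>F n in F. 0 \<le> cos (u n) - cos (v n)"
    "\<forall>\<^sub>F n in F. cos (u n) - cos (v n) \<le> sqrt ((y n)\<^sup>2 - 1) * sqrt ((z n)\<^sup>2 - 1)"
    "\<forall>\<^sub>F n in F. 0 \<le> u n \<and> u n \<le> v n \<and> v n \<le> pi"
    by (rule eventually_mono[OF ev], simp)+
  from tendsto_angle_defect_0[OF this(3) tendsto_sandwich[OF this(1,2) tendsto_const lim0]]
  have "((\<lambda>n. v n - u n) \<longlongrightarrow> 0) F" .
  then have "((\<lambda>n. pi - (v n - u n)) \<longlongrightarrow> pi - 0) F"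
    by (intro tendsto_intros)
  then show ?thesis by (simp add: u_def v_def algebra_simps)
qed

text \<open>With \<open>T = (sinh R)^2\<close> one has
  \<open>disk_cosh R R i = 1 + T * (1 + i)\<close>. Thus \<open>y * z / (Y * Z)\<close> is at least
  1, while \<open>x / (Y * Z)\<close> is of order 1/T because \<open>Y * Z\<close> is at least
  \<open>k * T^2\<close>; the cosine is squeezed to 1. This makes large constant radii a
  subsolution.\<close>

lemma tendsto_disk_angle_large:
  assumes c1: "c1_cosines p q s"
  shows "((\<lambda>R. disk_angle p q s R R R) \<longlongrightarrow> 0) at_top"
proof -
  define k where "k = (1 + q) * (1 + s)"
  have k: "0 < k" using c1 by (auto simp: k_def c1_cosines_def)
  have pos: "\<forall>\<^sub>F R::real in at_top. 0 < R" by (rule eventually_gt_at_top)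
  have fin: "\<forall>\<^sub>F R in at_top. 1 < disk_cosh R R q \<and> 1 < disk_cosh R R s \<and>
      0 < tri_det (disk_cosh R R p) (disk_cosh R R q) (disk_cosh R R s)"
    using pos by eventually_elim (use c1 tri_det_disks_pos disks_gt_1 in auto)
  have ev: "\<forall>\<^sub>F R in at_top. 1 - (2 / k * (inverse (sinh R))\<^sup>2 + 1 / k * (inverse (sinh R))\<^sup>2 * (inverse (sinh R))\<^sup>2)
      \<le> tri_cos (disk_cosh R R p) (disk_cosh R R q) (disk_cosh R R s) \<and>
      tri_cos (disk_cosh R R p) (disk_cosh R R q) (disk_cosh R R s) \<le> 1"
    using fin pos
  proof eventually_elim
    case (elim R)
    define T where "T = (sinh R)\<^sup>2"
    define x where "x = disk_cosh R R p"
    define y where "y = disk_cosh R R q"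
    define z where "z = disk_cosh R R s"
    have T: "0 < T" using elim by (simp add: T_def)
    have d: "disk_cosh R R i = 1 + T * (1 + i)" for i
      by (simp add: disk_cosh_def T_def cosh_square_eq algebra_simps flip: power2_eq_square)
    have q: "0 < 1 + q" "0 < 1 + s" "p \<le> 1" using c1 by (auto simp: c1_cosines_def)
    have lower: "T * (1 + i) \<le> sqrt ((1 + T * (1 + i))\<^sup>2 - 1)" and upper: "sqrt ((1 + T * (1 + i))\<^sup>2 - 1) \<le> 1 + T * (1 + i)"
      if "0 < 1 + i" for i
    proof -
      have "0 < T * (1 + i)" using T that by simp
      then show "T * (1 + i) \<le> sqrt ((1 + T * (1 + i))\<^sup>2 - 1)"
        by (intro real_le_rsqrt) (simp add: power2_eq_square algebra_simps)
      show "sqrt ((1 + T * (1 + i))\<^sup>2 - 1) \<le> 1 + T * (1 + i)"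
        using \<open>0 < T * (1 + i)\<close> by (intro real_le_lsqrt) auto
    qed
    define Y where "Y = sqrt (y\<^sup>2 - 1)"
    define Z where "Z = sqrt (z\<^sup>2 - 1)"
    have Y: "T * (1 + q) \<le> Y" "Y \<le> y" "T * (1 + s) \<le> Z" "Z \<le> z"
      using lower upper q by (auto simp: Y_def Z_def y_def z_def d)
    have TT: "0 < T * (1 + q)" "0 < T * (1 + s)" using T q by auto
    have YZ: "0 < Y" "0 < Z" "0 < Y * Z" using Y TT by auto
    have "1 \<le> y * z / (Y * Z)" using Y YZ by (simp add: mult_mono)
    moreover have "x / (Y * Z) \<le> (2 * T + 1) / (k * T\<^sup>2)"
    proof (rule frac_le)
      show "k * T\<^sup>2 \<le> Y * Z"
        using mult_mono[OF Y(1,3)] TT YZ by (simp add: k_def power2_eq_square algebra_simps)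
      show "x \<le> 2 * T + 1"
        using mult_left_mono[OF q(3), of T] T by (simp add: x_def d algebra_simps)
    qed (use T k in auto)
    moreover have "(2 * T + 1) / (k * T\<^sup>2) = 2 / k * inverse T + 1 / k * inverse T * inverse T"
      using T k by (simp add: field_simps power2_eq_square)
    ultimately have "1 - (2 / k * inverse T + 1 / k * inverse T * inverse T) \<le> (y * z - x) / (Y * Z)"
      by (simp add: diff_divide_distrib)
    moreover have "tri_cos x y z \<le> 1" using tri_cos_bounds elim by (auto simp: x_def y_def z_def less_imp_le)
    ultimately show ?case
      by (simp add: tri_cos_def x_def y_def z_def Y_def Z_def T_def power_inverse)
  qed
  have "((\<lambda>R::real. inverse (sinh R)) \<longlongrightarrow> 0) at_top"
    by (intro tendsto_inverse_0_at_top sinh_real_at_top)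
  then have "((\<lambda>R::real. 1 - (2 / k * (inverse (sinh R))\<^sup>2 + 1 / k * (inverse (sinh R))\<^sup>2 * (inverse (sinh R))\<^sup>2))
     \<longlongrightarrow> 1 - (2 / k * 0\<^sup>2 + 1 / k * 0\<^sup>2 * 0\<^sup>2)) at_top"
    by (intro tendsto_intros)
  then have lower: "((\<lambda>R::real. 1 - (2 / k * (inverse (sinh R))\<^sup>2 + 1 / k * (inverse (sinh R))\<^sup>2 * (inverse (sinh R))\<^sup>2))
     \<longlongrightarrow> 1) at_top" by simp
  have "((\<lambda>R. tri_cos (disk_cosh R R p) (disk_cosh R R q) (disk_cosh R R s)) \<longlongrightarrow> 1) at_top"
    by (rule tendsto_sandwich[OF _ _ lower tendsto_const]) (use ev in \<open>auto elim: eventually_mono\<close>)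
  from tendsto_tri_angle_arccos[OF this _ fin] show ?thesis
    by (simp add: disk_angle_def)
qed

section \<open>Corner angles of a face\<close>

lemma cosh_gt_1: "0 < t \<Longrightarrow> 1 < cosh (t :: real)"
  using cosh_real_ge_1[of t] cosh_real_one_iff[of t] by linarith

text \<open>The limit of the sum of the angles of \<open>f\<close> at \<open>D\<close> when exactly the radii in \<open>D\<close> shrink to zero.\<close>

definition shrink_limit :: "('v set \<Rightarrow> real) \<Rightarrow> 'v set \<Rightarrow> 'v set \<Rightarrow> real" where
  "shrink_limit \<Theta> f D = (if card D = 1 then pi - \<Theta> (f - D) else pi)"

locale disk_triangle =
  fixes \<Theta> :: "'v set \<Rightarrow> real" and f :: "'v set"
  assumes card_f: "card f = 3"
    and range: "\<And>e. e \<subseteq> f \<Longrightarrow> card e = 2 \<Longrightarrow> 0 \<le> \<Theta> e \<and> \<Theta> e < pi"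
    and c1: "cond_C1 {f} \<Theta>"
begin

lemma fin: "finite f"
  using card_f by (auto intro: card_ge_0_finite)

lemma obtain_other_vertices:
  assumes "u \<in> f"
  obtains v w where "f = {u, v, w}" "u \<noteq> v" "u \<noteq> w" "v \<noteq> w"
proof -
  have "card (f - {u}) = 2" using assms card_f fin by simp
  then obtain v w where "f - {u} = {v, w}" "v \<noteq> w" by (auto simp: card_2_iff)
  then show ?thesis using that[of v w] assms by auto
qed

lemma c1_cosines_Theta:
  assumes "f = {u, v, w}" "u \<noteq> v" "u \<noteq> w" "v \<noteq> w"
  shows "c1_cosines (cos (\<Theta> {v, w})) (cos (\<Theta> {u, w})) (cos (\<Theta> {u, v}))"
proof -
  have *: "-1 < cos (\<Theta> {a, b})" if "a \<in> f" "b \<in> f" "a \<noteq> b" for a b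
    using range[of "{a, b}"] that cos_monotone_0_pi[of "\<Theta> {a, b}" pi] by auto
  have **: "0 \<le> cos (\<Theta> {b, c}) + cos (\<Theta> {a, c}) * cos (\<Theta> {a, b})"
    if "f = {a, b, c}" "a \<noteq> b" "b \<noteq> c" "a \<noteq> c" for a b c
    using c1 that unfolding cond_C1_def by blast
  have "f = {v, u, w}" "f = {w, u, v}" using assms(1) by auto
  then show ?thesis
    unfolding c1_cosines_def using *[of v w] *[of u w] *[of u v] **[of u v w] **[of v u w] **[of w u v] assms
    by (auto simp: insert_commute mult.commute)
qed

text \<open>The choices in \<open>corner_angle\<close> return the other two vertices in an unknown
  order, but one that does not depend on \<open>r\<close>; a single enumeration therefore serves all
  radius vectors.\<close>

lemma corner_angle_hangle:
  assumes "u \<in> f"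
  obtains a b where "f = {u, a, b}" "u \<noteq> a" "u \<noteq> b" "a \<noteq> b"
    "\<And>r. corner_angle \<Theta> r f u =
      hangle (hlen (r a) (r b) (\<Theta> {a, b})) (hlen (r u) (r a) (\<Theta> {u, a})) (hlen (r u) (r b) (\<Theta> {u, b}))"
proof -
  obtain v w where f: "f = {u, v, w}" "u \<noteq> v" "u \<noteq> w" "v \<noteq> w"
    using obtain_other_vertices[OF assms] .
  define a where "a = (SOME a. a \<in> f - {u})"
  define b where "b = (SOME b. b \<in> f - {u, a})"
  have "a \<in> f - {u}" unfolding a_def by (rule someI[of _ v]) (use f in auto)
  then have a: "a = v \<or> a = w" using f by auto
  then have "\<exists>b. b \<in> f - {u, a}" using f by auto
  then have "b \<in> f - {u, a}" unfolding b_def by (rule someI_ex)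
  then have "a = v \<and> b = w \<or> a = w \<and> b = v" using a f by auto
  then have "f = {u, a, b}" "u \<noteq> a" "u \<noteq> b" "a \<noteq> b" using f by auto
  moreover have "corner_angle \<Theta> r f u =
      hangle (hlen (r a) (r b) (\<Theta> {a, b})) (hlen (r u) (r a) (\<Theta> {u, a})) (hlen (r u) (r b) (\<Theta> {u, b}))" for r
    by (simp add: corner_angle_def Let_def a_def b_def)
  ultimately show ?thesis using that by blast
qed

lemma corner_angle_eq:
  assumes f: "f = {u, v, w}" "u \<noteq> v" "u \<noteq> w" "v \<noteq> w" and r: "\<forall>x\<in>f. 0 < r x"
  shows "corner_angle \<Theta> r f u =
    disk_angle (cos (\<Theta> {v, w})) (cos (\<Theta> {u, w})) (cos (\<Theta> {u, v})) (r u) (r v) (r w)"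
proof -
  have *: "hangle (hlen (r a) (r b) (\<Theta> {a, b})) (hlen (r u) (r a) (\<Theta> {u, a})) (hlen (r u) (r b) (\<Theta> {u, b}))
     = disk_angle (cos (\<Theta> {a, b})) (cos (\<Theta> {u, b})) (cos (\<Theta> {u, a})) (r u) (r a) (r b)"
    if "f = {u, a, b}" "u \<noteq> a" "u \<noteq> b" "a \<noteq> b" for a b
  proof -
    have "1 < disk_cosh (r a) (r b) (cos (\<Theta> {a, b}))" "1 < disk_cosh (r u) (r a) (cos (\<Theta> {u, a}))"
       "1 < disk_cosh (r u) (r b) (cos (\<Theta> {u, b}))"
      using disks_gt_1[OF c1_cosines_Theta[OF that], of "r u" "r b" "r a"] r that by auto
    then have "hangle (hlen (r a) (r b) (\<Theta> {a, b})) (hlen (r u) (r a) (\<Theta> {u, a})) (hlen (r u) (r b) (\<Theta> {u, b}))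
      = tri_angle (disk_cosh (r a) (r b) (cos (\<Theta> {a, b}))) (disk_cosh (r u) (r a) (cos (\<Theta> {u, a}))) 
          (disk_cosh (r u) (r b) (cos (\<Theta> {u, b})))"
      unfolding hlen_def disk_cosh_def[symmetric] by (intro hangle_arcosh) auto
    also have "\<dots> = disk_angle (cos (\<Theta> {a, b})) (cos (\<Theta> {u, b})) (cos (\<Theta> {u, a})) (r u) (r a) (r b)"
      unfolding disk_angle_def by (rule tri_angle_commute)
    finally show ?thesis .
  qed
  obtain a b where ab: "f = {u, a, b}" "u \<noteq> a" "u \<noteq> b" "a \<noteq> b"
    and eq: "corner_angle \<Theta> r f u =
      hangle (hlen (r a) (r b) (\<Theta> {a, b})) (hlen (r u) (r a) (\<Theta> {u, a})) (hlen (r u) (r b) (\<Theta> {u, b}))"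
    using corner_angle_hangle[of u thesis] f(1) by auto
  have "a = v \<and> b = w \<or> a = w \<and> b = v" using ab f by (metis insertE insertI1 insertI2 singletonD)
  then show ?thesis
  proof
    assume "a = v \<and> b = w"
    then show ?thesis unfolding eq using *[OF f] by simp
  next
    assume "a = w \<and> b = v"
    then show ?thesis
      unfolding eq using *[OF ab] by (simp add: insert_commute[of w v] disk_angle_commute[of _ _ _ _ "r w"])
  qed
qed

lemma sum_corner_angle_eq:
  assumes f: "f = {u, v, w}" "u \<noteq> v" "u \<noteq> w" "v \<noteq> w" and r: "\<forall>x\<in>f. 0 < r x"
  defines "p \<equiv> cos (\<Theta> {v, w})" and "q \<equiv> cos (\<Theta> {u, w})" and "s \<equiv> cos (\<Theta> {u, v})"
  shows "(\<Sum>x\<in>f. corner_angle \<Theta> r f x) = disk_angle p q s (r u) (r v) (r w)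
    + disk_angle q p s (r v) (r u) (r w) + disk_angle s p q (r w) (r u) (r v)"
proof -
  have "f = {v, u, w}" "f = {w, u, v}" using f by auto
  with corner_angle_eq[OF f r] corner_angle_eq[of v u w r] corner_angle_eq[of w u v r] f r
  have "corner_angle \<Theta> r f u = disk_angle p q s (r u) (r v) (r w)"
    "corner_angle \<Theta> r f v = disk_angle q p s (r v) (r u) (r w)"
    "corner_angle \<Theta> r f w = disk_angle s p q (r w) (r u) (r v)"
    unfolding p_def q_def s_def by (auto simp: insert_commute)
  moreover have "(\<Sum>x\<in>f. corner_angle \<Theta> r f x) =
     corner_angle \<Theta> r f u + corner_angle \<Theta> r f v + corner_angle \<Theta> r f w"
    using f(2-4) by (subst (1) f(1)) (simp add: add_ac)
  ultimately show ?thesis by simp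
qed

section \<open>Positivity, monotonicity and comparison of the angles of one face\<close>

lemma corner_angle_pos:
  assumes "u \<in> f" and r: "\<forall>x\<in>f. 0 < r x"
  shows "0 < corner_angle \<Theta> r f u"
proof -
  obtain v w where f: "f = {u, v, w}" "u \<noteq> v" "u \<noteq> w" "v \<noteq> w"
    using obtain_other_vertices[OF assms(1)] .
  have pos: "0 < r u" "0 < r v" "0 < r w" using r f(1) by auto
  note c = c1_cosines_Theta[OF f]
  show "0 < corner_angle \<Theta> r f u"
    unfolding corner_angle_eq[OF f r] disk_angle_def
    using tri_angle_bounds(1)[OF disks_gt_1(2,3)[OF c pos(1,3,2)] tri_det_disks_pos[OF c pos]] by blast
qed

lemma corner_angle_mono:
  assumes u: "u \<in> f" "r u = r' u" and r: "\<forall>x\<in>f. 0 < r x" and le: "\<forall>x\<in>f. r x \<le> r' x"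
  shows "corner_angle \<Theta> r f u \<le> corner_angle \<Theta> r' f u"
proof -
  obtain v w where f: "f = {u, v, w}" "u \<noteq> v" "u \<noteq> w" "v \<noteq> w"
    using obtain_other_vertices[OF u(1)] .
  have r': "\<forall>x\<in>f. 0 < r' x" using r le by (meson less_le_trans)
  define p where "p = cos (\<Theta> {v, w})"
  define q where "q = cos (\<Theta> {u, w})"
  define s where "s = cos (\<Theta> {u, v})"
  have c: "c1_cosines p q s" using c1_cosines_Theta[OF f] by (simp add: p_def q_def s_def)
  have "disk_angle p q s (r u) (r v) (r w) \<le> disk_angle p q s (r u) (r' v) (r w)"
    using r le f(1) by (intro disk_angle_mono[OF c]) auto
  also have "\<dots> \<le> disk_angle p q s (r u) (r' v) (r' w)"
    unfolding disk_angle_commute[of p q s]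
    using r r' le f(1) by (intro disk_angle_mono[OF c1_cosines_swap(3)[OF c]]) auto
  finally show ?thesis
    unfolding corner_angle_eq[OF f r] corner_angle_eq[OF f r'] p_def q_def s_def using u(2) by simp
qed

lemma sum_corner_angle_upd:
  assumes v: "v \<in> f" and r: "\<forall>x\<in>f. 0 < r x" and t: "r v < t"
  shows "(\<Sum>x\<in>f. corner_angle \<Theta> (r(v := t)) f x) < (\<Sum>x\<in>f. corner_angle \<Theta> r f x)"
proof -
  obtain u w where "f = {v, u, w}" "v \<noteq> u" "v \<noteq> w" "u \<noteq> w"
    using obtain_other_vertices[OF v] .
  then have f: "f = {u, v, w}" "u \<noteq> v" "u \<noteq> w" "v \<noteq> w" by auto
  have r': "\<forall>x\<in>f. 0 < (r(v := t)) x" using r v t by force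
  show ?thesis
    unfolding sum_corner_angle_eq[OF f r] sum_corner_angle_eq[OF f r']
    using sum_disk_angle_strict[OF c1_cosines_Theta[OF f], of "r u" "r w" "r v" t] r f t by auto
qed

lemma corner_angle_cong:
  assumes "\<forall>x\<in>f. r x = r' x" "u \<in> f"
  shows "corner_angle \<Theta> r f u = corner_angle \<Theta> r' f u"
  by (rule corner_angle_hangle[OF assms(2)]) (use assms(1) in simp)

lemma sum_corner_angle_upd_le:
  assumes "v \<in> f" "\<forall>x\<in>f. 0 < r x" "r v \<le> t"
  shows "(\<Sum>x\<in>f. corner_angle \<Theta> (r(v := t)) f x) \<le> (\<Sum>x\<in>f. corner_angle \<Theta> r f x)"
  using sum_corner_angle_upd[OF assms(1,2), of t] assms(3) by (cases "r v = t") auto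

lemma sum_corner_angle_strict:
  assumes r: "\<forall>x\<in>f. 0 < r x" and le: "\<forall>x\<in>f. r x \<le> r' x" and u: "u \<in> f" "r u < r' u"
  shows "(\<Sum>x\<in>f. corner_angle \<Theta> r' f x) < (\<Sum>x\<in>f. corner_angle \<Theta> r f x)"
proof -
  obtain v w where f: "f = {u, v, w}" "u \<noteq> v" "u \<noteq> w" "v \<noteq> w"
    using obtain_other_vertices[OF u(1)] .
  \<comment> \<open>The radii are raised one vertex at a time: the change at \<open>u\<close> gives
    the strict drop, the other two changes a weak one.\<close>
  define r1 where "r1 = r(u := r' u)"
  define r2 where "r2 = r1(v := r' v)"
  have uf: "v \<in> f" "w \<in> f" using f by auto
  have r1: "\<forall>x\<in>f. 0 < r1 x" using r u by (force simp: r1_def)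
  have r2: "\<forall>x\<in>f. 0 < r2 x" using r1 r le uf by (fastforce simp: r2_def)
  have "(\<Sum>x\<in>f. corner_angle \<Theta> r' f x) = (\<Sum>x\<in>f. corner_angle \<Theta> (r2(w := r' w)) f x)"
    using f by (intro sum.cong refl corner_angle_cong) (auto simp: r2_def r1_def)
  also have "\<dots> \<le> (\<Sum>x\<in>f. corner_angle \<Theta> r2 f x)"
    using le uf r2 f by (intro sum_corner_angle_upd_le) (auto simp: r2_def r1_def)
  also have "\<dots> \<le> (\<Sum>x\<in>f. corner_angle \<Theta> r1 f x)"
    unfolding r2_def using le uf r1 f by (intro sum_corner_angle_upd_le) (auto simp: r1_def)
  also have "\<dots> < (\<Sum>x\<in>f. corner_angle \<Theta> r f x)"
    unfolding r1_def using u r by (intro sum_corner_angle_upd)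
  finally show ?thesis .
qed

text \<open>Passing through \<open>max r r'\<close>: raising the radii in \<open>D\<close> lowers the total angle while the angles
  outside \<open>D\<close> do not drop; lowering the remaining radii only lowers the angles in \<open>D\<close>.\<close>

lemma sum_corner_angle_compare:
  assumes r: "\<forall>x\<in>f. 0 < r x" "\<forall>x\<in>f. 0 < r' x"
  defines "D \<equiv> {x\<in>f. r x < r' x}"
  assumes D: "D \<noteq> {}"
  shows "(\<Sum>x\<in>D. corner_angle \<Theta> r' f x) < (\<Sum>x\<in>D. corner_angle \<Theta> r f x)"
proof -
  define m where "m x = max (r x) (r' x)" for x
  have sub: "D \<subseteq> f" by (auto simp: D_def)
  have split: "(\<Sum>x\<in>f. g x) = (\<Sum>x\<in>f - D. g x) + (\<Sum>x\<in>D. g x)" for g :: "'v \<Rightarrow> real"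
    using sum.subset_diff[OF sub fin] .
  obtain u where u: "u \<in> f" "r u < r' u" using D by (auto simp: D_def)
  have "(\<Sum>x\<in>D. corner_angle \<Theta> r' f x) \<le> (\<Sum>x\<in>D. corner_angle \<Theta> m f x)"
    using r by (intro sum_mono corner_angle_mono) (auto simp: D_def m_def)
  moreover have "(\<Sum>x\<in>f - D. corner_angle \<Theta> r f x) \<le> (\<Sum>x\<in>f - D. corner_angle \<Theta> m f x)"
    using r by (intro sum_mono corner_angle_mono) (auto simp: D_def m_def)
  moreover have "(\<Sum>x\<in>f. corner_angle \<Theta> m f x) < (\<Sum>x\<in>f. corner_angle \<Theta> r f x)"
    using r u by (intro sum_corner_angle_strict[of r m u]) (auto simp: m_def)
  ultimately show ?thesis
    unfolding split by linarith
qed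

section \<open>Angles of a face with converging, possibly vanishing, radii\<close>

lemma tendsto_corner_angle:
  assumes u: "u \<in> f" and r: "\<And>n. \<forall>x\<in>f. 0 < r n x" and lim: "\<forall>x\<in>f. (\<lambda>n. r n x) \<longlonglongrightarrow> m x"
    and m: "\<forall>x\<in>f. 0 < m x"
  shows "(\<lambda>n. corner_angle \<Theta> (r n) f u) \<longlonglongrightarrow> corner_angle \<Theta> m f u"
proof -
  obtain v w where f: "f = {u, v, w}" "u \<noteq> v" "u \<noteq> w" "v \<noteq> w"
    using obtain_other_vertices[OF u] .
  show ?thesis
    unfolding corner_angle_eq[OF f r] corner_angle_eq[OF f m]
    using lim r m f(1) disks_gt_1[OF c1_cosines_Theta[OF f], of "m u" "m w" "m v"]
    by (intro tendsto_disk_angle c1_cosines_Theta[OF f]) auto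
qed

text \<open>In the limit \<open>u\<close> has distances \<open>m v\<close> and \<open>m w\<close>
  from the other centers, so it is a common point of the two circles, where the radii enclose the
  supplement of the exterior intersection angle.\<close>

lemma tendsto_corner_angle_shrink:
  assumes f: "f = {u, v, w}" "u \<noteq> v" "u \<noteq> w" "v \<noteq> w"
    and r: "\<And>n. \<forall>x\<in>f. 0 < r n x" and lim: "\<forall>x\<in>f. (\<lambda>n. r n x) \<longlonglongrightarrow> m x"
    and m: "m u = 0" "0 < m v" "0 < m w"
  shows "(\<lambda>n. corner_angle \<Theta> (r n) f u) \<longlonglongrightarrow> pi - \<Theta> {v, w}"
proof -
  have "(\<lambda>n. corner_angle \<Theta> (r n) f u) \<longlonglongrightarrow>
     disk_angle (cos (\<Theta> {v, w})) (cos (\<Theta> {u, w})) (cos (\<Theta> {u, v})) (m u) (m v) (m w)"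
    unfolding corner_angle_eq[OF f r]
    using lim r m f(1) by (intro tendsto_disk_angle c1_cosines_Theta[OF f]) (auto simp: disk_cosh_def cosh_gt_1)
  moreover have "disk_angle (cos (\<Theta> {v, w})) (cos (\<Theta> {u, w})) (cos (\<Theta> {u, v})) (m u) (m v) (m w)
      = pi - \<Theta> {v, w}"
  proof -
    have s: "sqrt ((cosh t)\<^sup>2 - 1) = sinh t" if "0 < t" for t :: real
      using that by (simp add: cosh_square_eq)
    have "disk_angle (cos (\<Theta> {v, w})) (cos (\<Theta> {u, w})) (cos (\<Theta> {u, v})) (m u) (m v) (m w)
      = arccos (- cos (\<Theta> {v, w}))"
      using m by (simp add: disk_angle_def tri_angle_def tri_cos_def disk_cosh_def s field_simps)
    also have "\<dots> = arccos (cos (pi - \<Theta> {v, w}))" by (simp add: cos_diff)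
    also have "\<dots> = pi - \<Theta> {v, w}"
      using range[of "{v, w}"] f by (intro arccos_cos) auto
    finally show ?thesis .
  qed
  ultimately show ?thesis by simp
qed

text \<open>Both sides at \<open>u\<close> tend to length \<open>m u\<close> while the opposite side
  collapses.\<close>

lemma tendsto_corner_angle_0:
  assumes f: "f = {u, v, w}" "u \<noteq> v" "u \<noteq> w" "v \<noteq> w"
    and r: "\<And>n. \<forall>x\<in>f. 0 < r n x" and lim: "\<forall>x\<in>f. (\<lambda>n. r n x) \<longlonglongrightarrow> m x"
    and m: "0 < m u" "m v = 0" "m w = 0"
  shows "(\<lambda>n. corner_angle \<Theta> (r n) f u) \<longlonglongrightarrow> 0"
proof -
  have "(\<lambda>n. corner_angle \<Theta> (r n) f u) \<longlonglongrightarrow>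
     disk_angle (cos (\<Theta> {v, w})) (cos (\<Theta> {u, w})) (cos (\<Theta> {u, v})) (m u) (m v) (m w)"
    unfolding corner_angle_eq[OF f r]
    using lim r m f(1) by (intro tendsto_disk_angle c1_cosines_Theta[OF f]) (auto simp: disk_cosh_def cosh_gt_1)
  moreover have "disk_angle (cos (\<Theta> {v, w})) (cos (\<Theta> {u, w})) (cos (\<Theta> {u, v})) (m u) (m v) (m w) = 0"
    using m square_gt_1[OF cosh_gt_1[OF m(1)]]
    by (simp add: disk_angle_def tri_angle_def tri_cos_def disk_cosh_def power2_eq_square)
  ultimately show ?thesis by simp
qed

lemma tendsto_sum_corner_angle_pi:
  assumes f: "f = {u, v, w}" "u \<noteq> v" "u \<noteq> w" "v \<noteq> w"
    and r: "\<And>n. \<forall>x\<in>f. 0 < r n x" and lim: "\<forall>x\<in>f. (\<lambda>n. r n x) \<longlonglongrightarrow> m x"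
    and m: "m u = 0" "m v = 0"
  shows "(\<lambda>n. \<Sum>x\<in>f. corner_angle \<Theta> (r n) f x) \<longlonglongrightarrow> pi"
  unfolding sum_corner_angle_eq[OF f r]
  using lim r m f(1) by (intro tendsto_sum_disk_angle_pi c1_cosines_Theta[OF f]) auto

text \<open>If exactly two radii vanish, the two angles are not controlled separately; their sum is
  the total, which tends to \<open>pi\<close>, minus the third angle, which tends to 0.\<close>

lemma tendsto_shrink_limit:
  assumes r: "\<And>n. \<forall>x\<in>f. 0 < r n x" and lim: "\<forall>x\<in>f. (\<lambda>n. r n x) \<longlonglongrightarrow> m x"
    and m: "\<forall>x\<in>f. 0 \<le> m x"
  defines "D \<equiv> {x\<in>f. m x = 0}"
  assumes D: "D \<noteq> {}"
  shows "(\<lambda>n. \<Sum>x\<in>D. corner_angle \<Theta> (r n) f x) \<longlonglongrightarrow> shrink_limit \<Theta> f D"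
proof -
  obtain u where "u \<in> D" using D by auto
  then have u: "u \<in> f" "m u = 0" by (auto simp: D_def)
  obtain v w where f: "f = {u, v, w}" "u \<noteq> v" "u \<noteq> w" "v \<noteq> w"
    using obtain_other_vertices[OF u(1)] .
  have two: ?thesis
    if f: "f = {u, v, w}" "u \<noteq> v" "u \<noteq> w" "v \<noteq> w" and m: "m u = 0" "m v = 0" "0 < m w" for u v w
  proof -
    have D: "D = {u, v}" "f = insert w {u, v}" using f m by (auto simp: D_def)
    have f': "f = {w, u, v}" "w \<noteq> u" "w \<noteq> v" "u \<noteq> v" using f by auto
    have "(\<lambda>n. (\<Sum>x\<in>f. corner_angle \<Theta> (r n) f x) - corner_angle \<Theta> (r n) f w) \<longlonglongrightarrow> pi - 0"
      by (intro tendsto_diff tendsto_sum_corner_angle_pi[OF f r lim] tendsto_corner_angle_0[OF f' r lim] m)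
    moreover have "(\<Sum>x\<in>f. corner_angle \<Theta> (r n) f x) - corner_angle \<Theta> (r n) f w
       = (\<Sum>x\<in>D. corner_angle \<Theta> (r n) f x)" for n
      unfolding D(1) by (subst (1) D(2)) (use f in simp)
    moreover have "card D \<noteq> 1" using D(1) f by simp
    ultimately show ?thesis by (simp add: shrink_limit_def)
  qed
  have "m v = 0 \<or> 0 < m v" "m w = 0 \<or> 0 < m w" using m f by force+
  then consider "0 < m v" "0 < m w" | "m v = 0" "0 < m w" | "0 < m v" "m w = 0" | "m v = 0" "m w = 0"
    by blast
  then show ?thesis
  proof cases
    case 1
    then have "D = {u}" "f - D = {v, w}" using u f by (auto simp: D_def)
    then show ?thesis
      using tendsto_corner_angle_shrink[OF f r lim u(2) 1] by (simp add: shrink_limit_def)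
  next
    case 2
    then show ?thesis using two[OF f u(2)] by blast
  next
    case 3
    have "f = {u, w, v}" using f by auto
    then show ?thesis using two[of u w v] f u 3 by blast
  next
    case 4
    then have "D = f" using u f by (auto simp: D_def)
    then show ?thesis
      using tendsto_sum_corner_angle_pi[OF f r lim u(2) 4(1)] card_f by (simp add: shrink_limit_def)
  qed
qed

lemma sum_corner_angle_less_pi:
  assumes r: "\<forall>x\<in>f. 0 < r x"
  shows "(\<Sum>x\<in>f. corner_angle \<Theta> r f x) < pi"
proof -
  have "f \<noteq> {}" using card_f by auto
  then obtain u where u: "u \<in> f" by auto
  obtain v w where f: "f = {u, v, w}" "u \<noteq> v" "u \<noteq> w" "v \<noteq> w"
    using obtain_other_vertices[OF u] .
  have c: "c1_cosines (cos (\<Theta> {v, w})) (cos (\<Theta> {u, w})) (cos (\<Theta> {u, v}))"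
    using c1_cosines_Theta[OF f] .
  show ?thesis
    unfolding sum_corner_angle_eq[OF f r] disk_angle_def disk_cosh_commute[of "r v" "r u"]
      disk_cosh_commute[of "r w"]
    using r f(1) by (intro tri_angle_sum disks_gt_1[OF c] tri_det_disks_pos[OF c]) auto
qed

text \<open>For several vertices this is the angle sum bound \<open>pi\<close>. For a single vertex
  \<open>u\<close>, shrinking its radius strictly increases the angle at \<open>u\<close>, whose
  limit is the claimed bound.\<close>

lemma sum_corner_angle_less_shrink_limit:
  assumes r: "\<forall>x\<in>f. 0 < r x" and D: "D \<subseteq> f" "D \<noteq> {}"
  shows "(\<Sum>x\<in>D. corner_angle \<Theta> r f x) < shrink_limit \<Theta> f D"
proof (cases "card D = 1")
  case False
  have "(\<Sum>x\<in>D. corner_angle \<Theta> r f x) \<le> (\<Sum>x\<in>f. corner_angle \<Theta> r f x)"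
    using corner_angle_pos[OF _ r] D fin by (intro sum_mono2) (auto intro: less_imp_le)
  then show ?thesis using sum_corner_angle_less_pi[OF r] False by (simp add: shrink_limit_def)
next
  case True
  then obtain u where Du: "D = {u}" by (auto simp: card_1_singleton_iff)
  then have u: "u \<in> f" using D by auto
  obtain v w where f: "f = {u, v, w}" "u \<noteq> v" "u \<noteq> w" "v \<noteq> w"
    using obtain_other_vertices[OF u] .
  \<comment> \<open>The summand 2 makes \<open>R 0\<close> already halve the radius at
    \<open>u\<close>, which leaves room for a strict inequality before the limit is taken.\<close>
  define R where "R n = r(u := r u / (real n + 2))" for n
  have R: "\<forall>x\<in>f. 0 < R n x" for n using r by (auto simp: R_def)
  have less: "corner_angle \<Theta> r2 f u < corner_angle \<Theta> r1 f u"
    if "\<forall>x\<in>f. 0 < r1 x" "\<forall>x\<in>f. 0 < r2 x" "\<forall>x\<in>f - {u}. r1 x = r2 x" "r1 u < r2 u" for r1 r2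
  proof -
    have "{x\<in>f. r1 x < r2 x} = {u}" using that u by force
    with sum_corner_angle_compare[OF that(1,2)] show ?thesis by simp
  qed
  have "(\<lambda>n. r u / (real n + 2)) \<longlonglongrightarrow> 0"
    by (intro tendsto_divide_0[OF tendsto_const] filterlim_at_top_imp_at_infinity
        filterlim_tendsto_add_at_top[OF tendsto_const, of "\<lambda>n. real n" sequentially 2, simplified add.commute]
        filterlim_real_sequentially)
  then have "\<forall>x\<in>f. (\<lambda>n. R n x) \<longlonglongrightarrow> (r(u := 0)) x"
    by (auto simp: R_def)
  from tendsto_corner_angle_shrink[OF f R this]
  have lim: "(\<lambda>n. corner_angle \<Theta> (R n) f u) \<longlonglongrightarrow> pi - \<Theta> {v, w}"
    using r f by auto
  have "corner_angle \<Theta> r f u < corner_angle \<Theta> (R 0) f u"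
    using r u by (intro less R) (auto simp: R_def)
  also have "corner_angle \<Theta> (R 0) f u \<le> pi - \<Theta> {v, w}"
  proof (rule tendsto_lowerbound[OF lim])
    have "corner_angle \<Theta> (R 0) f u \<le> corner_angle \<Theta> (R n) f u" for n
    proof (cases "n = 0")
      case False
      then show ?thesis
        using r u by (intro less_imp_le less R) (auto simp: R_def field_simps)
    qed simp
    then show "\<forall>\<^sub>F n in sequentially. corner_angle \<Theta> (R 0) f u \<le> corner_angle \<Theta> (R n) f u"
      by simp
  qed simp
  finally have "corner_angle \<Theta> r f u < pi - \<Theta> {v, w}" .
  moreover have "f - D = {v, w}" using f Du by auto
  ultimately show ?thesis using Du by (simp add: shrink_limit_def)
qed

lemma tendsto_corner_angle_large:
  assumes "u \<in> f"
  shows "((\<lambda>R. corner_angle \<Theta> (\<lambda>_. R) f u) \<longlongrightarrow> 0) at_top"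
proof -
  obtain v w where f: "f = {u, v, w}" "u \<noteq> v" "u \<noteq> w" "v \<noteq> w"
    using obtain_other_vertices[OF assms] .
  have "\<forall>\<^sub>F R in at_top. disk_angle (cos (\<Theta> {v, w})) (cos (\<Theta> {u, w})) (cos (\<Theta> {u, v})) R R R
      = corner_angle \<Theta> (\<lambda>_. R) f u"
    using eventually_gt_at_top[of 0] by eventually_elim (simp add: corner_angle_eq[OF f])
  then show ?thesis
    using tendsto_disk_angle_large[OF c1_cosines_Theta[OF f]] by (rule Lim_transform_eventually[rotated])
qed

end

section \<open>Cone angles\<close>

definition cone_angle :: "'v set set \<Rightarrow> ('v set \<Rightarrow> real) \<Rightarrow> ('v \<Rightarrow> real) \<Rightarrow> 'v \<Rightarrow> real" where
  "cone_angle F \<Theta> r v = (\<Sum>f\<in>{f\<in>F. v \<in> f}. corner_angle \<Theta> r f v)"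

locale disk_complex =
  fixes V :: "'v set" and F :: "'v set set" and \<Theta> :: "'v set \<Rightarrow> real"
  assumes fin_V: "finite V" and V_eq: "V = \<Union>F" and disk_triangle: "\<And>f. f \<in> F \<Longrightarrow> disk_triangle \<Theta> f"
begin

lemma fin_F: "finite F"
  using fin_V V_eq by (simp add: finite_UnionD)

abbreviation "cone \<equiv> cone_angle F \<Theta>"

lemma face_subset: "f \<in> F \<Longrightarrow> f \<subseteq> V"
  using V_eq by auto

lemma sum_cone_angle:
  assumes "A \<subseteq> V"
  shows "(\<Sum>v\<in>A. cone r v) = (\<Sum>f\<in>{f\<in>F. f \<inter> A \<noteq> {}}. \<Sum>v\<in>f \<inter> A. corner_angle \<Theta> r f v)"
proof -
  have "(\<Sum>v\<in>A. cone r v) = (\<Sum>f\<in>F. \<Sum>v\<in>{v\<in>A. v \<in> f}. corner_angle \<Theta> r f v)"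
    unfolding cone_angle_def using finite_subset[OF assms fin_V] fin_F by (rule sum.swap_restrict)
  also have "\<dots> = (\<Sum>f\<in>{f\<in>F. f \<inter> A \<noteq> {}}. \<Sum>v\<in>{v\<in>A. v \<in> f}. corner_angle \<Theta> r f v)"
    using fin_F by (intro sum.mono_neutral_right) (auto intro!: sum.neutral)
  also have "\<dots> = (\<Sum>f\<in>{f\<in>F. f \<inter> A \<noteq> {}}. \<Sum>v\<in>f \<inter> A. corner_angle \<Theta> r f v)"
    by (intro sum.cong) auto
  finally show ?thesis .
qed

lemma faces_meeting_nonempty:
  assumes "A \<subseteq> V" "A \<noteq> {}"
  shows "{f\<in>F. f \<inter> A \<noteq> {}} \<noteq> {}"
  using assms V_eq by fastforce

lemma cone_angle_mono:
  assumes "v \<in> V" "r v = r' v" "\<forall>x\<in>V. 0 < r x" "\<forall>x\<in>V. r x \<le> r' x"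
  shows "cone r v \<le> cone r' v"
  unfolding cone_angle_def
  using assms face_subset by (intro sum_mono disk_triangle.corner_angle_mono[OF disk_triangle]) auto

lemma tendsto_cone_angle:
  assumes "v \<in> V" "\<And>n. \<forall>x\<in>V. 0 < r n x" "\<forall>x\<in>V. (\<lambda>n. r n x) \<longlonglongrightarrow> m x" "\<forall>x\<in>V. 0 < m x"
  shows "(\<lambda>n. cone (r n) v) \<longlonglongrightarrow> cone m v"
  unfolding cone_angle_def
  using assms face_subset
  by (intro tendsto_sum disk_triangle.tendsto_corner_angle[OF disk_triangle]) (auto, blast+)

lemma cone_angle_pos:
  assumes "v \<in> V" "\<forall>x\<in>V. 0 < r x"
  shows "0 < cone r v"
proof -
  have "{f\<in>F. v \<in> f} \<noteq> {}" using assms V_eq by auto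
  then show ?thesis
    unfolding cone_angle_def using fin_F assms(2) face_subset
    by (intro sum_pos disk_triangle.corner_angle_pos[OF disk_triangle]) auto
qed

lemma tendsto_cone_angle_large:
  assumes "v \<in> V"
  shows "((\<lambda>R. cone (\<lambda>_. R) v) \<longlongrightarrow> 0) at_top"
proof -
  have "((\<lambda>R. cone (\<lambda>_. R) v) \<longlongrightarrow> (\<Sum>f\<in>{f\<in>F. v \<in> f}. 0)) at_top"
    unfolding cone_angle_def
    by (intro tendsto_sum disk_triangle.tendsto_corner_angle_large[OF disk_triangle]) auto
  then show ?thesis by simp
qed

lemma cone_angle_inj_le:
  assumes r: "\<forall>v\<in>V. 0 < r v" "\<forall>v\<in>V. 0 < r' v" and eq: "\<forall>v\<in>V. cone r v = cone r' v" and v: "v \<in> V"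
  shows "r' v \<le> r v"
proof (rule ccontr)
  define A where "A = {x\<in>V. r x < r' x}"
  assume "\<not> ?thesis"
  then have A: "A \<subseteq> V" "A \<noteq> {}" using v by (auto simp: A_def)
  have "(\<Sum>v\<in>A. cone r' v) < (\<Sum>v\<in>A. cone r v)"
    unfolding sum_cone_angle[OF A(1)]
  proof (rule sum_strict_mono)
    fix f assume f: "f \<in> {f \<in> F. f \<inter> A \<noteq> {}}"
    then have "f \<inter> A = {x\<in>f. r x < r' x}" using face_subset by (auto simp: A_def)
    then show "(\<Sum>v\<in>f \<inter> A. corner_angle \<Theta> r' f v) < (\<Sum>v\<in>f \<inter> A. corner_angle \<Theta> r f v)"
      using disk_triangle.sum_corner_angle_compare[OF disk_triangle, of f r r'] f r face_subset[of f] by auto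
  qed (use fin_F faces_meeting_nonempty[OF A] in auto)
  moreover have "(\<Sum>v\<in>A. cone r v) = (\<Sum>v\<in>A. cone r' v)"
    using eq A by (intro sum.cong) auto
  ultimately show False by simp
qed

lemma cone_angle_inj:
  assumes "\<forall>v\<in>V. 0 < r v" "\<forall>v\<in>V. 0 < r' v" "\<forall>v\<in>V. cone r v = cone r' v" "v \<in> V"
  shows "r v = r' v"
  using cone_angle_inj_le[OF assms] cone_angle_inj_le[of r' r v] assms by auto

lemma sum_cone_angle_less:
  assumes r: "\<forall>v\<in>V. 0 < r v" and A: "A \<subseteq> V" "A \<noteq> {}"
  shows "(\<Sum>v\<in>A. cone r v) < (\<Sum>f\<in>{f\<in>F. f \<inter> A \<noteq> {}}. shrink_limit \<Theta> f (f \<inter> A))"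
  unfolding sum_cone_angle[OF A(1)]
proof (rule sum_strict_mono)
  fix f assume "f \<in> {f \<in> F. f \<inter> A \<noteq> {}}"
  then show "(\<Sum>v\<in>f \<inter> A. corner_angle \<Theta> r f v) < shrink_limit \<Theta> f (f \<inter> A)"
    using r face_subset[of f]
    by (intro disk_triangle.sum_corner_angle_less_shrink_limit[OF disk_triangle]) auto
qed (use fin_F faces_meeting_nonempty[OF A] in auto)

section \<open>Perron's method for prescribed cone angles \<open>s\<close>\<close>

context
  fixes s :: "'v \<Rightarrow> real"
begin

definition subsolutions :: "('v \<Rightarrow> real) set" where
  "subsolutions = {r. \<forall>v\<in>V. 0 < r v \<and> cone r v \<le> s v}"

text \<open>At each vertex the minimum agrees with one of the two vectors, and lowering the other
  radii cannot raise the cone angle there.\<close>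

lemma min_subsolutions:
  assumes "r \<in> subsolutions" "r' \<in> subsolutions"
  shows "(\<lambda>v. min (r v) (r' v)) \<in> subsolutions"
  unfolding subsolutions_def mem_Collect_eq
proof (intro ballI conjI)
  fix v assume v: "v \<in> V"
  have pos: "\<forall>x\<in>V. 0 < min (r x) (r' x)" using assms by (auto simp: subsolutions_def)
  then show "0 < min (r v) (r' v)" using v by blast
  show "cone (\<lambda>v. min (r v) (r' v)) v \<le> s v"
  proof (cases "r v \<le> r' v")
    case True
    then have "cone (\<lambda>v. min (r v) (r' v)) v \<le> cone r v"
      using v pos by (intro cone_angle_mono) auto
    then show ?thesis using assms v by (force simp: subsolutions_def)
  next
    case False
    then have "cone (\<lambda>v. min (r v) (r' v)) v \<le> cone r' v"
      using v pos by (intro cone_angle_mono) auto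
    then show ?thesis using assms v by (force simp: subsolutions_def)
  qed
qed

lemma subsolutions_nonempty:
  assumes "\<forall>v\<in>V. 0 < s v"
  shows "subsolutions \<noteq> {}"
proof -
  have "\<forall>\<^sub>F R in at_top. \<forall>v\<in>V. cone (\<lambda>_. R) v < s v"
    using fin_V assms order_tendstoD(2)[OF tendsto_cone_angle_large]
    by (intro eventually_ball_finite) auto
  with eventually_gt_at_top[of "0::real"] have "\<forall>\<^sub>F R in at_top. 0 < R \<and> (\<forall>v\<in>V. cone (\<lambda>_. R) v < s v)"
    by eventually_elim auto
  then obtain R where "0 < R" "\<forall>v\<in>V. cone (\<lambda>_. R) v < s v"
    using eventually_happens' trivial_limit_at_top_linorder by blast
  then have "(\<lambda>_. R) \<in> subsolutions" by (auto simp: subsolutions_def intro: less_imp_le)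
  then show ?thesis by blast
qed

definition least_radius :: "'v \<Rightarrow> real" where
  "least_radius v = (INF r\<in>subsolutions. r v)"

lemma least_radius_le:
  assumes "r \<in> subsolutions" "v \<in> V"
  shows "least_radius v \<le> r v"
  unfolding least_radius_def using assms
  by (intro cINF_lower) (auto simp: subsolutions_def bdd_below_def intro!: exI[of _ 0] less_imp_le)

lemma least_radius_nonneg:
  assumes "subsolutions \<noteq> {}" "v \<in> V"
  shows "0 \<le> least_radius v"
  unfolding least_radius_def using assms
  by (intro cINF_greatest) (auto simp: subsolutions_def less_imp_le)

text \<open>One subsolution must be near the infimum at all vertices at once; taking minima of
  finitely many subsolutions achieves this.\<close>

lemma least_radius_approx:
  assumes ne: "subsolutions \<noteq> {}" and \<epsilon>: "0 < \<epsilon>"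
  shows "\<exists>r\<in>subsolutions. \<forall>v\<in>V. r v < least_radius v + \<epsilon>"
proof -
  have "\<exists>r\<in>subsolutions. \<forall>v\<in>B. r v < least_radius v + \<epsilon>" if "finite B" "B \<subseteq> V" for B
    using that
  proof (induction rule: finite_induct)
    case empty
    then show ?case using ne by auto
  next
    case (insert b B)
    then obtain r where r: "r \<in> subsolutions" "\<forall>v\<in>B. r v < least_radius v + \<epsilon>" by auto
    have "least_radius b < least_radius b + \<epsilon>" using \<epsilon> by simp
    then obtain r' where r': "r' \<in> subsolutions" "r' b < least_radius b + \<epsilon>"
      unfolding least_radius_def[of b] using insert.prems ne
      by (subst (asm) cINF_less_iff) (auto simp: subsolutions_def bdd_below_def intro!: exI[of _ 0] less_imp_le)
    show ?case
      by (rule bexI[OF _ min_subsolutions[OF r(1) r'(1)]]) (use r r' in auto)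
  qed
  then show ?thesis using fin_V by blast
qed

lemma cone_angle_exists:
  assumes pos: "\<forall>v\<in>V. 0 < s v"
    and less: "\<And>A. A \<subseteq> V \<Longrightarrow> A \<noteq> {} \<Longrightarrow>
      (\<Sum>v\<in>A. s v) < (\<Sum>f\<in>{f\<in>F. f \<inter> A \<noteq> {}}. shrink_limit \<Theta> f (f \<inter> A))"
  shows "\<exists>r. (\<forall>v\<in>V. 0 < r v) \<and> (\<forall>v\<in>V. cone r v = s v)"
proof -
  note ne = subsolutions_nonempty[OF pos]
  define m where "m = least_radius"
  have m0: "\<forall>v\<in>V. 0 \<le> m v" using least_radius_nonneg[OF ne] by (simp add: m_def)
  have "\<exists>r\<in>subsolutions. \<forall>v\<in>V. r v < m v + 1 / (real n + 1)" for n
    unfolding m_def by (intro least_radius_approx ne) auto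
  then obtain r where r: "\<And>n. r n \<in> subsolutions" "\<And>n. \<forall>v\<in>V. r n v < m v + 1 / (real n + 1)"
    by metis
  have r_pos: "\<forall>x\<in>V. 0 < r n x" and r_le: "\<forall>x\<in>V. cone (r n) x \<le> s x" for n
    using r(1)[of n] by (auto simp: subsolutions_def)
  have lim: "\<forall>v\<in>V. (\<lambda>n. r n v) \<longlonglongrightarrow> m v"
  proof
    fix v assume v: "v \<in> V"
    show "(\<lambda>n. r n v) \<longlonglongrightarrow> m v"
    proof (rule tendsto_sandwich[OF _ _ tendsto_const])
      show "\<forall>\<^sub>F n in sequentially. m v \<le> r n v"
        using least_radius_le[OF r(1) v] by (simp add: m_def)
      show "\<forall>\<^sub>F n in sequentially. r n v \<le> m v + 1 / (real n + 1)"
        using r(2) v by (auto intro!: always_eventually less_imp_le)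
      have "(\<lambda>n. m v + 1 / real (Suc n)) \<longlonglongrightarrow> m v + 0"
        by (intro tendsto_add tendsto_const LIMSEQ_Suc[OF lim_1_over_n])
      then show "(\<lambda>n. m v + 1 / (real n + 1)) \<longlonglongrightarrow> m v" by (simp add: add.commute)
    qed
  qed
  define Z where "Z = {v\<in>V. m v = 0}"
  have "Z = {}"
  proof (rule ccontr)
    assume "Z \<noteq> {}"
    moreover have Z: "Z \<subseteq> V" by (auto simp: Z_def)
    ultimately have lt: "(\<Sum>v\<in>Z. s v) < (\<Sum>f\<in>{f\<in>F. f \<inter> Z \<noteq> {}}. shrink_limit \<Theta> f (f \<inter> Z))"
      by (intro less)
    have "(\<lambda>n. \<Sum>v\<in>Z. cone (r n) v) \<longlonglongrightarrow> (\<Sum>f\<in>{f\<in>F. f \<inter> Z \<noteq> {}}. shrink_limit \<Theta> f (f \<inter> Z))"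
      unfolding sum_cone_angle[OF Z]
    proof (rule tendsto_sum)
      fix f assume f: "f \<in> {f \<in> F. f \<inter> Z \<noteq> {}}"
      then have "f \<subseteq> V" using face_subset by simp
      then have "f \<inter> Z = {x\<in>f. m x = 0}" by (auto simp: Z_def)
      then show "(\<lambda>n. \<Sum>v\<in>f \<inter> Z. corner_angle \<Theta> (r n) f v) \<longlonglongrightarrow> shrink_limit \<Theta> f (f \<inter> Z)"
        using disk_triangle.tendsto_shrink_limit[OF disk_triangle, of f r m] f \<open>f \<subseteq> V\<close> r_pos lim m0
        by (auto simp: subset_iff)
    qed
    moreover have "(\<Sum>v\<in>Z. cone (r n) v) \<le> (\<Sum>v\<in>Z. s v)" for n
      using r_le Z by (intro sum_mono) auto
    ultimately have "(\<Sum>f\<in>{f\<in>F. f \<inter> Z \<noteq> {}}. shrink_limit \<Theta> f (f \<inter> Z)) \<le> (\<Sum>v\<in>Z. s v)"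
      by (intro tendsto_upperbound[of _ _ sequentially]) auto
    with lt show False by simp
  qed
  then have m_pos: "\<forall>v\<in>V. 0 < m v" using m0 by (force simp: Z_def)
  \<comment> \<open>Convergence of the cone angles is available only at positive limits, so the
    bound passes to \<open>m\<close> only now that \<open>Z\<close> is empty.\<close>
  have m_le: "cone m v \<le> s v" if v: "v \<in> V" for v
    using tendsto_cone_angle[OF v r_pos lim m_pos] r_le v
    by (intro tendsto_upperbound[of _ _ sequentially]) auto
  have "cone m v = s v" if v: "v \<in> V" for v
  proof (rule ccontr)
    assume "cone m v \<noteq> s v"
    with m_le[OF v] have lt: "cone m v < s v" by simp
    \<comment> \<open>Slightly lowering the radius at \<open>v\<close> keeps the cone angle at
      \<open>v\<close> below \<open>s v\<close> by continuity and does not raise the others, so a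
      subsolution below the infimum appears. The double successor keeps the factor at least 1/2,
      hence positive.\<close>
    define t where "t n = m(v := m v * (1 - 1 / real (Suc (Suc n))))" for n
    have t_pos: "\<forall>x\<in>V. 0 < t n x" for n using m_pos by (auto simp: t_def)
    have t_le: "\<forall>x\<in>V. t n x \<le> m x" for n using m_pos v by (auto simp: t_def field_simps)
    have "(\<lambda>n. m v * (1 - 1 / real (Suc (Suc n)))) \<longlonglongrightarrow> m v * (1 - 0)"
      by (intro tendsto_intros LIMSEQ_Suc[OF LIMSEQ_Suc[OF lim_1_over_n]])
    then have "(\<lambda>n. t n x) \<longlonglongrightarrow> m x" for x
      by (cases "x = v") (simp_all add: t_def)
    then have "\<forall>x\<in>V. (\<lambda>n. t n x) \<longlonglongrightarrow> m x" by blast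
    from order_tendstoD(2)[OF tendsto_cone_angle[OF v t_pos this m_pos] lt]
    obtain n where n: "cone (t n) v < s v"
      using eventually_happens'[OF sequentially_bot] by blast
    have "t n \<in> subsolutions"
      unfolding subsolutions_def mem_Collect_eq
    proof (intro ballI conjI)
      fix x assume x: "x \<in> V"
      then show "0 < t n x" using t_pos by blast
      show "cone (t n) x \<le> s x"
      proof (cases "x = v")
        case False
        then have "cone (t n) x \<le> cone m x"
          using x t_pos t_le by (intro cone_angle_mono) (auto simp: t_def)
        then show ?thesis using m_le[OF x] by simp
      qed (use n in simp)
    qed
    from least_radius_le[OF this v] m_pos v show False by (auto simp: m_def[symmetric] t_def field_simps)
  qed
  with m_pos show ?thesis by blast
qed

end

end

section \<open>Counting edges and faces\<close>

text \<open>The edges missing \<open>A\<close> are the pairs inside \<open>f - A\<close>, so the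
  count is \<open>3 choose 2\<close> minus \<open>card (f - A) choose 2\<close>.\<close>

lemma card_edges_meeting:
  assumes "card f = 3"
  shows "card {e. e \<subseteq> f \<and> card e = 2 \<and> e \<inter> A \<noteq> {}} =
    (if card (f \<inter> A) = 0 then 0 else if card (f \<inter> A) = 1 then 2 else 3)"
proof -
  have fin: "finite f" using assms by (auto intro: card_ge_0_finite)
  have "{e. e \<subseteq> f \<and> card e = 2 \<and> e \<inter> A \<noteq> {}} = {e. e \<subseteq> f \<and> card e = 2} - {e. e \<subseteq> f - A \<and> card e = 2}"
    by auto
  moreover have "{e. e \<subseteq> f - A \<and> card e = 2} \<subseteq> {e. e \<subseteq> f \<and> card e = 2}"
    by auto
  moreover have "finite {e. e \<subseteq> f - A \<and> card e = 2}"
    using fin by (auto intro: finite_subset[of _ "Pow f"])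
  ultimately have "card {e. e \<subseteq> f \<and> card e = 2 \<and> e \<inter> A \<noteq> {}} = (3 choose 2) - (card (f - A) choose 2)"
    using fin assms by (simp add: card_Diff_subset n_subsets)
  moreover have "card (f - A) = 3 - card (f \<inter> A)" "card (f \<inter> A) \<le> 3"
    using fin assms card_Diff_subset_Int[of f A] card_mono[of f "f \<inter> A"] by auto
  moreover have "card (f \<inter> A) = 0 \<or> card (f \<inter> A) = 1 \<or> card (f \<inter> A) = 2 \<or> card (f \<inter> A) = 3"
    using calculation(3) by linarith
  ultimately show ?thesis
    by (auto simp: numeral_eq_Suc)
qed

lemma finite_tri_edges:
  assumes "finite F" "\<forall>f\<in>F. card f = 3"
  shows "finite (tri_edges F)"
proof (rule finite_subset)
  show "tri_edges F \<subseteq> Pow (\<Union>F)" by (auto simp: tri_edges_def)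
  have "finite f" if "f \<in> F" for f
    by (rule card_ge_0_finite) (use assms that in simp)
  then show "finite (Pow (\<Union>F))" using assms(1) by simp
qed

text \<open>Both sides count the incidences between faces and edges meeting \<open>A\<close>: by
  faces on the left, by edges on the right, where a boundary edge lies in one face and any other
  edge in two.\<close>

lemma edge_face_double_count:
  assumes F: "finite F" "\<forall>f\<in>F. card f = 3"
    and deg: "\<forall>e\<in>tri_edges F. edge_deg F e = 1 \<or> edge_deg F e = 2"
  shows "2 * card {f\<in>F. card (f \<inter> A) = 1} + 3 * card {f\<in>F. 2 \<le> card (f \<inter> A)} =
    card {e\<in>bd_edges F. e \<inter> A \<noteq> {}} + 2 * card {e\<in>tri_edges F - bd_edges F. e \<inter> A \<noteq> {}}"
proof -
  define E where "E = {e\<in>tri_edges F. e \<inter> A \<noteq> {}}"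
  have fin: "finite E" using finite_tri_edges[OF F] by (auto simp: E_def)
  have "(\<Sum>f\<in>F. card {e\<in>E. e \<subseteq> f}) = (\<Sum>e\<in>E. edge_deg F e)"
    using F(1) fin by (intro sum_multicount_gen) (auto simp: edge_deg_def)
  also have "\<dots> = (\<Sum>e\<in>{e\<in>bd_edges F. e \<inter> A \<noteq> {}} \<union> {e\<in>tri_edges F - bd_edges F. e \<inter> A \<noteq> {}}. edge_deg F e)"
    by (intro sum.cong) (auto simp: E_def bd_edges_def)
  also have "\<dots> = (\<Sum>e\<in>{e\<in>bd_edges F. e \<inter> A \<noteq> {}}. edge_deg F e)
      + (\<Sum>e\<in>{e\<in>tri_edges F - bd_edges F. e \<inter> A \<noteq> {}}. edge_deg F e)"
    using fin by (intro sum.union_disjoint) (auto elim!: finite_subset[rotated] simp: E_def bd_edges_def)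
  also have "\<dots> = (\<Sum>e\<in>{e\<in>bd_edges F. e \<inter> A \<noteq> {}}. 1)
      + (\<Sum>e\<in>{e\<in>tri_edges F - bd_edges F. e \<inter> A \<noteq> {}}. 2)"
    using deg by (intro arg_cong2[of _ _ _ _ "(+)"] sum.cong) (auto simp: bd_edges_def)
  also have "(\<Sum>f\<in>F. card {e\<in>E. e \<subseteq> f}) =
      (\<Sum>f\<in>F. (if card (f \<inter> A) = 1 then 2 else 0) + (if 2 \<le> card (f \<inter> A) then 3 else 0))"
  proof (rule sum.cong[OF refl])
    fix f assume f: "f \<in> F"
    then have "{e\<in>E. e \<subseteq> f} = {e. e \<subseteq> f \<and> card e = 2 \<and> e \<inter> A \<noteq> {}}"
      by (auto simp: E_def tri_edges_def)
    then show "card {e\<in>E. e \<subseteq> f} =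
        (if card (f \<inter> A) = 1 then 2 else 0) + (if 2 \<le> card (f \<inter> A) then 3 else 0)"
      using card_edges_meeting[of f A] F f by auto
  qed
  also have "\<dots> = 2 * card {f\<in>F. card (f \<inter> A) = 1} + 3 * card {f\<in>F. 2 \<le> card (f \<inter> A)}"
    using F(1) by (simp add: sum.distrib sum.If_cases Int_def)
  finally show ?thesis by simp
qed

text \<open>A pair in \<open>Lk F A\<close> is a face with exactly one vertex in \<open>A\<close>,
  recorded as that vertex and its opposite edge.\<close>

lemma sum_Lk:
  assumes F: "\<forall>f\<in>F. card f = 3"
  shows "(\<Sum>p\<in>Lk F A. h (fst p)) = (\<Sum>f\<in>{f\<in>F. card (f \<inter> A) = 1}. h (f - A) :: real)"
proof (rule sum.reindex_bij_witness[of _ "\<lambda>f. (f - A, the_elem (f \<inter> A))" "\<lambda>(e, v). insert v e"])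
  fix p assume p: "p \<in> Lk F A"
  obtain e v where ev: "p = (e, v)" by (cases p)
  with p have *: "v \<in> A" "e \<inter> A = {}" "insert v e \<in> F" "insert v e \<inter> A = {v}" "insert v e - A = e"
    by (auto simp: Lk_def)
  then show "(case p of (e, v) \<Rightarrow> insert v e) \<in> {f\<in>F. card (f \<inter> A) = 1}"
    "((case p of (e, v) \<Rightarrow> insert v e) - A, the_elem ((case p of (e, v) \<Rightarrow> insert v e) \<inter> A)) = p"
    "h ((case p of (e, v) \<Rightarrow> insert v e) - A) = h (fst p)"
    by (simp_all add: ev)
next
  fix f assume "f \<in> {f\<in>F. card (f \<inter> A) = 1}"
  then have f: "f \<in> F" "card (f \<inter> A) = 1" by auto
  then obtain v where v: "f \<inter> A = {v}" by (auto simp: card_1_singleton_iff)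
  then have ins: "insert v (f - A) = f" and vA: "v \<in> A" by auto
  then show "(case (f - A, the_elem (f \<inter> A)) of (e, v) \<Rightarrow> insert v e) = f"
    using v by simp
  have "card (f - A) = 2" using F f card_Diff_subset_Int[of f A] by (simp add: v)
  then have "f - A \<in> tri_edges F" using f by (auto simp: tri_edges_def)
  then show "(f - A, the_elem (f \<inter> A)) \<in> Lk F A"
    using f vA v ins by (auto simp: Lk_def)
qed

text \<open>Faces in \<open>F1\<close> yield the sum over \<open>Lk F A\<close>, and those in
  \<open>F2\<close> yield \<open>pi\<close> each. Subtracting twice the number of faces meeting
  \<open>A\<close> from the double count expresses \<open>card F2\<close> through edges and faces;
  the vertex terms of the Euler characteristics cancel against the sum of \<open>pi\<close> and
  \<open>2 * pi\<close> over \<open>A\<close>.\<close>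

lemma sum_shrink_limit:
  assumes F: "finite F" "\<forall>f\<in>F. card f = 3"
    and deg: "\<forall>e\<in>tri_edges F. edge_deg F e = 1 \<or> edge_deg F e = 2"
    and A: "finite A"
  shows "(\<Sum>f\<in>{f\<in>F. f \<inter> A \<noteq> {}}. shrink_limit \<Theta> f (f \<inter> A)) =
    (\<Sum>v\<in>A. if v \<in> bd_verts F then pi else 2 * pi)
    - (- (\<Sum>p\<in>Lk F A. pi - \<Theta> (fst p)) + 2 * pi * of_int (chi_int F A) + pi * of_int (chi_bd F A))"
proof -
  define F1 where "F1 = {f\<in>F. card (f \<inter> A) = 1}"
  define F2 where "F2 = {f\<in>F. 2 \<le> card (f \<inter> A)}"
  have nz: "f \<inter> A \<noteq> {} \<longleftrightarrow> card (f \<inter> A) = 1 \<or> 2 \<le> card (f \<inter> A)" for f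
  proof -
    have "f \<inter> A \<noteq> {} \<longleftrightarrow> 0 < card (f \<inter> A)" using A by (simp add: card_gt_0_iff)
    also have "\<dots> \<longleftrightarrow> card (f \<inter> A) = 1 \<or> 2 \<le> card (f \<inter> A)" by linarith
    finally show ?thesis .
  qed
  have un: "{f\<in>F. f \<inter> A \<noteq> {}} = F1 \<union> F2" by (auto simp: nz F1_def F2_def)
  have fin: "finite F1" "finite F2" "F1 \<inter> F2 = {}" using F by (auto simp: F1_def F2_def)
  have "(\<Sum>f\<in>{f\<in>F. f \<inter> A \<noteq> {}}. shrink_limit \<Theta> f (f \<inter> A))
    = (\<Sum>f\<in>F1. shrink_limit \<Theta> f (f \<inter> A)) + (\<Sum>f\<in>F2. shrink_limit \<Theta> f (f \<inter> A))"
    unfolding un using fin by (rule sum.union_disjoint)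
  also have "(\<Sum>f\<in>F1. shrink_limit \<Theta> f (f \<inter> A)) = (\<Sum>p\<in>Lk F A. pi - \<Theta> (fst p))"
    unfolding sum_Lk[OF F(2), of "\<lambda>e. pi - \<Theta> e"] F1_def
    by (intro sum.cong) (auto simp: shrink_limit_def Diff_Int)
  also have "(\<Sum>f\<in>F2. shrink_limit \<Theta> f (f \<inter> A)) = (\<Sum>f\<in>F2. pi)"
    by (intro sum.cong) (auto simp: shrink_limit_def F2_def)
  finally have 1: "(\<Sum>f\<in>{f\<in>F. f \<inter> A \<noteq> {}}. shrink_limit \<Theta> f (f \<inter> A)) =
      (\<Sum>p\<in>Lk F A. pi - \<Theta> (fst p)) + pi * real (card F2)"
    by simp
  have "card {f\<in>F. f \<inter> A \<noteq> {}} = card F1 + card F2"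
    unfolding un using fin by (rule card_Un_disjoint)
  moreover have "2 * card F1 + 3 * card F2 =
    card {e\<in>bd_edges F. e \<inter> A \<noteq> {}} + 2 * card {e\<in>tri_edges F - bd_edges F. e \<inter> A \<noteq> {}}"
    unfolding F1_def F2_def by (rule edge_face_double_count[OF F deg])
  ultimately have 2: "real (card F2) = 2 * real (card {e\<in>tri_edges F - bd_edges F. e \<inter> A \<noteq> {}})
      + real (card {e\<in>bd_edges F. e \<inter> A \<noteq> {}}) - 2 * real (card {f\<in>F. f \<inter> A \<noteq> {}})"
    by linarith
  have 3: "(\<Sum>v\<in>A. if v \<in> bd_verts F then pi else 2 * pi) =
      pi * real (card (A \<inter> bd_verts F)) + 2 * pi * real (card (A - bd_verts F))"
    using A by (simp add: sum.If_cases Int_def set_diff_eq)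
  show ?thesis
    unfolding 1 2 3 chi_int_def chi_bd_def by (simp add: algebra_simps)
qed

section \<open>From cone angles on a triangulated surface to the curvature map\<close>

lemma disk_complex_tri_surface:
  assumes "tri_surface V F" "\<forall>e\<in>tri_edges F. 0 \<le> \<Theta> e \<and> \<Theta> e < pi" "cond_C1 F \<Theta>"
  shows "disk_complex V F \<Theta>"
proof (rule disk_complex.intro)
  show "finite V" "V = \<Union>F" using assms(1) unfolding tri_surface_def by blast+
  fix f assume f: "f \<in> F"
  show "disk_triangle \<Theta> f"
  proof (rule disk_triangle.intro)
    show "card f = 3" using assms(1) f by (simp add: tri_surface_def)
    show "0 \<le> \<Theta> e \<and> \<Theta> e < pi" if "e \<subseteq> f" "card e = 2" for e
      using assms(2) f that by (auto simp: tri_edges_def)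
    show "cond_C1 {f} \<Theta>" using assms(3) f unfolding cond_C1_def by blast
  qed
qed

theorem theorem0p4:
  fixes V :: "'v set" and F :: "'v set set" and \<Theta> :: "'v set \<Rightarrow> real"
  assumes "tri_surface V F"
    and "\<forall>e\<in>tri_edges F. 0 \<le> \<Theta> e \<and> \<Theta> e < pi"
    and "cond_C1 F \<Theta>"
  shows "(\<forall>r r'. (\<forall>v\<in>V. r v > 0) \<longrightarrow> (\<forall>v\<in>V. r' v > 0) \<longrightarrow>
            (\<forall>v\<in>V. Th F \<Theta> r v = Th F \<Theta> r' v) \<longrightarrow> (\<forall>v\<in>V. r v = r' v))
       \<and> (\<forall>K :: 'v \<Rightarrow> real.
            (\<exists>r. (\<forall>v\<in>V. r v > 0) \<and> (\<forall>v\<in>V. Th F \<Theta> r v = K v)) \<longleftrightarrow>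
            ((\<forall>v\<in>V - bd_verts F. K v < 2 * pi) \<and>
             (\<forall>v\<in>V \<inter> bd_verts F. K v < pi) \<and>
             (\<forall>A. A \<subseteq> V \<longrightarrow> A \<noteq> {} \<longrightarrow>
                (\<Sum>v\<in>A. K v) > - (\<Sum>p\<in>Lk F A. pi - \<Theta> (fst p))
                   + 2 * pi * of_int (chi_int F A) + pi * of_int (chi_bd F A))))"
proof -
  interpret disk_complex V F \<Theta> by (rule disk_complex_tri_surface[OF assms])
  \<comment> \<open>The cone angle of a vertex of zero curvature: prescribing \<open>K\<close> means
    prescribing the cone angles \<open>\<kappa> v - K v\<close>, and the pointwise bounds on
    \<open>K\<close> say that these are positive.\<close>
  define \<kappa> where "\<kappa> v = (if v \<in> bd_verts F then pi else 2 * pi)" for v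
  have Th: "Th F \<Theta> r v = \<kappa> v - cone r v" for r v
    by (simp add: Th_def cone_angle_def \<kappa>_def)
  have F: "\<forall>f\<in>F. card f = 3" "\<forall>e\<in>tri_edges F. edge_deg F e = 1 \<or> edge_deg F e = 2"
    using assms(1) by (simp_all add: tri_surface_def)
  \<comment> \<open>This turns the inequality for \<open>A\<close> into the statement that the
    prescribed cone angles on \<open>A\<close> sum to less than their collapse limit.\<close>
  have bound: "(\<Sum>f\<in>{f\<in>F. f \<inter> A \<noteq> {}}. shrink_limit \<Theta> f (f \<inter> A)) =
      (\<Sum>v\<in>A. \<kappa> v) - (- (\<Sum>p\<in>Lk F A. pi - \<Theta> (fst p)) + 2 * pi * of_int (chi_int F A) + pi * of_int (chi_bd F A))"
    if "A \<subseteq> V" for A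
    unfolding \<kappa>_def using sum_shrink_limit[OF fin_F F finite_subset[OF that fin_V]] .
  have "r v = r' v" if "\<forall>v\<in>V. r v > 0" "\<forall>v\<in>V. r' v > 0" "\<forall>v\<in>V. Th F \<Theta> r v = Th F \<Theta> r' v" "v \<in> V" for r r' v
    using cone_angle_inj[OF that(1,2) _ that(4)] that(3) by (simp add: Th)
  moreover have "(\<exists>r. (\<forall>v\<in>V. r v > 0) \<and> (\<forall>v\<in>V. Th F \<Theta> r v = K v)) \<longleftrightarrow>
            ((\<forall>v\<in>V - bd_verts F. K v < 2 * pi) \<and>
             (\<forall>v\<in>V \<inter> bd_verts F. K v < pi) \<and>
             (\<forall>A. A \<subseteq> V \<longrightarrow> A \<noteq> {} \<longrightarrow>
                (\<Sum>v\<in>A. K v) > - (\<Sum>p\<in>Lk F A. pi - \<Theta> (fst p))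
                   + 2 * pi * of_int (chi_int F A) + pi * of_int (chi_bd F A)))" (is "?L \<longleftrightarrow> ?R") for K
  proof
    assume ?L
    then obtain r where r: "\<forall>v\<in>V. r v > 0" and K: "\<forall>v\<in>V. K v = \<kappa> v - cone r v"
      by (auto simp: Th)
    have "K v < \<kappa> v" if "v \<in> V" for v using cone_angle_pos[OF that r] K that by simp
    then have "(\<forall>v\<in>V - bd_verts F. K v < 2 * pi) \<and> (\<forall>v\<in>V \<inter> bd_verts F. K v < pi)"
      by (force simp: \<kappa>_def)
    moreover have "(\<Sum>v\<in>A. K v) > - (\<Sum>p\<in>Lk F A. pi - \<Theta> (fst p))
                   + 2 * pi * of_int (chi_int F A) + pi * of_int (chi_bd F A)" if "A \<subseteq> V" "A \<noteq> {}" for A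
    proof -
      have "(\<Sum>v\<in>A. K v) = (\<Sum>v\<in>A. \<kappa> v - cone r v)" using K that by (intro sum.cong) auto
      then show ?thesis
        using sum_cone_angle_less[OF r that] bound[OF that(1)] by (simp add: sum_subtractf)
    qed
    ultimately show ?R by blast
  next
    assume R: ?R
    have "\<forall>v\<in>V. 0 < \<kappa> v - K v" using R by (auto simp: \<kappa>_def)
    moreover have "(\<Sum>v\<in>A. \<kappa> v - K v) < (\<Sum>f\<in>{f\<in>F. f \<inter> A \<noteq> {}}. shrink_limit \<Theta> f (f \<inter> A))"
      if "A \<subseteq> V" "A \<noteq> {}" for A
    proof -
      have "- (\<Sum>p\<in>Lk F A. pi - \<Theta> (fst p)) + 2 * pi * of_int (chi_int F A) + pi * of_int (chi_bd F A) < (\<Sum>v\<in>A. K v)"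
        using R that by blast
      then show ?thesis unfolding bound[OF that(1)] sum_subtractf by linarith
    qed
    ultimately obtain r where "\<forall>v\<in>V. 0 < r v" "\<forall>v\<in>V. cone r v = \<kappa> v - K v"
      using cone_angle_exists[of "\<lambda>v. \<kappa> v - K v"] by blast
    then show ?L by (intro exI[of _ r]) (auto simp: Th)
  qed
  ultimately show ?thesis by blast
qed

end
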